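(* If $m,n\in\mathbb{N}$ and $n\ge2$, then $C(m,n)\le\sqrt{\min\{m,n/2\}}$.
   Context: $M_{m,n}$ is the space of $m\times n$ complex matrices with the operator norm, i.e. $M_{m,n}=\mathcal{B}(\mathbb{C}^n,\mathbb{C}^m)$ where $\mathbb{C}^n,\mathbb{C}^m$ carry the $\ell^2$ norm. $D_n\subseteq M_{n,n}$ is the algebra of diagonal $n\times n$ matrices. A right $D_n$-module map on $M_{m,n}$ is a linear map $T\colon M_{m,n}\to M_{m,n}$ with $T(xd)=T(x)d$ for all $x\in M_{m,n}$, $d\in D_n$. For $s,t\in\mathbb{N}$, $M_{s,t}(M_{m,n})$ is identified with $M_{sm,tn}$ and carries the operator norm of that space; $T_{s,t}[x_{ij}]=[Tx_{ij}]$ on $M_{s,t}(M_{m,n})$. $\|T\|=\sup\{\|Tx\|\colon \|x\|\le1\}$ and $\|T\|_{cb}=\sup_{s,t\ge1}\|T_{s,t}\|$. Finally $C(m,n)=\sup\{\|T\|_{cb}\colon T \text{ a right } D_n\text{-module map on } M_{m,n},\ \|T\|\le1\}$. *)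

theory Defs
  imports
    "HOL-Analysis.L2_Norm"
    "HOL-Library.Extended_Real"
    "Jordan_Normal_Form.Matrix"
begin

text \<open>
  All norms are \<^typ>\<open>ereal\<close>-valued, so that every supremum below is a supremum in a
  complete lattice and its finiteness is never presupposed. A linear map on \<open>M_{m,n}\<close> is
  represented by a function on \<^typ>\<open>complex mat\<close> of which only the values on
  \<open>carrier_mat m n\<close> are ever used.
\<close>

definition l2_norm :: "complex vec \<Rightarrow> real" where
  "l2_norm v = L2_set (\<lambda>i. cmod (v $ i)) {..<dim_vec v}"

definition op_norm :: "complex mat \<Rightarrow> ereal" where
  "op_norm A = (SUP v \<in> {v \<in> carrier_vec (dim_col A). l2_norm v \<le> 1}. ereal (l2_norm (A *\<^sub>v v)))"

definition diagonal_algebra :: "nat \<Rightarrow> complex mat set" where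
  "diagonal_algebra n = {d \<in> carrier_mat n n. diagonal_mat d}"

definition linear_on_mat :: "nat \<Rightarrow> nat \<Rightarrow> (complex mat \<Rightarrow> complex mat) \<Rightarrow> bool" where
  "linear_on_mat m n T \<longleftrightarrow>
     (\<forall>x \<in> carrier_mat m n. T x \<in> carrier_mat m n) \<and>
     (\<forall>x \<in> carrier_mat m n. \<forall>y \<in> carrier_mat m n. T (x + y) = T x + T y) \<and>
     (\<forall>c. \<forall>x \<in> carrier_mat m n. T (c \<cdot>\<^sub>m x) = c \<cdot>\<^sub>m T x)"

definition right_diag_module_map :: "nat \<Rightarrow> nat \<Rightarrow> (complex mat \<Rightarrow> complex mat) \<Rightarrow> bool" where
  "right_diag_module_map m n T \<longleftrightarrow>
     linear_on_mat m n T \<and>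
     (\<forall>x \<in> carrier_mat m n. \<forall>d \<in> diagonal_algebra n. T (x * d) = T x * d)"

definition map_norm :: "nat \<Rightarrow> nat \<Rightarrow> (complex mat \<Rightarrow> complex mat) \<Rightarrow> ereal" where
  "map_norm m n T = (SUP x \<in> {x \<in> carrier_mat m n. op_norm x \<le> 1}. op_norm (T x))"

text \<open>
  An element \<open>[x_{pq}]\<close> of \<open>M_{s,t}(M_{m,n})\<close> is stored as the \<open>sm \<times> tn\<close> matrix with the
  \<open>m \<times> n\<close> blocks \<open>x_{pq}\<close>, where \<open>p < s\<close> and \<open>q < t\<close>.
\<close>

definition mat_block :: "nat \<Rightarrow> nat \<Rightarrow> complex mat \<Rightarrow> nat \<Rightarrow> nat \<Rightarrow> complex mat" where
  "mat_block m n X p q = mat m n (\<lambda>(i, j). X $$ (p * m + i, q * n + j))"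

definition amplification ::
  "nat \<Rightarrow> nat \<Rightarrow> nat \<Rightarrow> nat \<Rightarrow> (complex mat \<Rightarrow> complex mat) \<Rightarrow> complex mat \<Rightarrow> complex mat" where
  "amplification m n s t T X =
     mat (s * m) (t * n)
       (\<lambda>(i, j). T (mat_block m n X (i div m) (j div n)) $$ (i mod m, j mod n))"

definition cb_norm :: "nat \<Rightarrow> nat \<Rightarrow> (complex mat \<Rightarrow> complex mat) \<Rightarrow> ereal" where
  "cb_norm m n T =
     (SUP (s, t) \<in> {1..} \<times> {1..}. map_norm (s * m) (t * n) (amplification m n s t T))"

definition C_const :: "nat \<Rightarrow> nat \<Rightarrow> ereal" where
  "C_const m n =
     (SUP T \<in> {T. right_diag_module_map m n T \<and> map_norm m n T \<le> 1}. cb_norm m n T)"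

end

theory Submission
  imports Defs "HOL-Analysis.Convex"
begin

text \<open>
  A right \<open>D_n\<close>-module map \<open>T\<close> acts on each column separately: the \<open>j\<close>-th column of \<open>T x\<close> is
  \<open>A_j x_j\<close> for some \<open>m \<times> m\<close> matrix \<open>A_j\<close>. If \<open>X = [X_1 \<dots> X_n]\<close> is a contraction with blocks
  \<open>X_j\<close> (the columns of \<open>X\<close> that stem from the \<open>j\<close>-th column of \<open>M_{m,n}\<close>) and \<open>w\<close> is a row vector,
  then the row \<open>w\<close> times the amplified image of \<open>X\<close> has squared norm \<open>N_1 + \<dots> + N_n\<close>, where \<open>N_j\<close>
  is the squared norm of \<open>w (1 \<otimes> A_j) X_j\<close>. Two bounds on this sum are proved for contractive \<open>T\<close>.

  Bound by \<open>m \<parallel>w\<parallel>\<^sup>2\<close>. Amplifying the columns only does not increase the norm of \<open>T\<close>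
  (\<open>row_amplification_bound\<close>), because for a fixed \<open>w\<close> each block \<open>X_j\<close> can be replaced by a single
  column. A row vector in \<open>\<complex>\<^sup>s \<otimes> \<complex>\<^sup>m\<close> is a sum of \<open>m\<close> elementary tensors, one for each unit
  vector of \<open>\<complex>\<^sup>m\<close>, and for an elementary tensor only the columns are amplified; the
  Cauchy-Schwarz inequality gives the factor \<open>m\<close> (\<open>amplification_bound_card\<close>).

  Bound by \<open>n/2 \<parallel>w\<parallel>\<^sup>2\<close>. It suffices that \<open>N_i + N_j \<le> \<parallel>w\<parallel>\<^sup>2\<close> for \<open>i \<noteq> j\<close>, as one sees by
  averaging over all pairs; that is, for two columns the completely bounded norm and the norm agree
  (\<open>amplification_bound_two_columns\<close>). With \<open>a_j = w (1 \<otimes> A_j)\<close>, the supremum of \<open>N_i + N_j\<close>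
  over all contractions depends only on \<open>S = \<parallel>a_i\<parallel>\<^sup>2 + \<parallel>a_j\<parallel>\<^sup>2\<close> and \<open>c = \<bar>\<langle>a_i, a_j\<rangle>\<bar>\<close>: with
  \<open>W = \<parallel>w\<parallel>\<^sup>2\<close>, it is at most \<open>W\<close> if \<open>S \<le> 2 W\<close> and \<open>W S \<le> W\<^sup>2 + c\<^sup>2\<close> (\<open>two_column_bound\<close>). For
  rows \<open>w\<close> in \<open>\<complex>\<^sup>m\<close> these inequalities follow from the contractivity of \<open>T\<close>
  (\<open>vector_state_bounds\<close>). For \<open>w\<close> in \<open>\<complex>\<^sup>s \<otimes> \<complex>\<^sup>m\<close> the numbers \<open>W\<close>, \<open>S\<close> and
  \<open>\<langle>a_i, a_j\<rangle>\<close> are those of a mixture of \<open>s\<close> vectors in \<open>\<complex>\<^sup>m\<close>. There is one vector with the same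
  \<open>W\<close> and \<open>\<langle>a_i, a_j\<rangle>\<close> and with at least the same \<open>S\<close> (\<open>pure_state_dominates_mixture\<close>), so
  the inequalities pass from it to the mixture.

  Norms are handled through the action of a matrix on row vectors, given as functions on finite
  index sets; the pairing of a row with a matrix is bilinear, without complex conjugation.
\<close>

section \<open>Row vectors on finite index sets\<close>

definition sqn :: "'i set \<Rightarrow> ('i \<Rightarrow> complex) \<Rightarrow> real" where
  "sqn I x = (\<Sum>i\<in>I. (cmod (x i))\<^sup>2)"

definition cip :: "'i set \<Rightarrow> ('i \<Rightarrow> complex) \<Rightarrow> ('i \<Rightarrow> complex) \<Rightarrow> complex" where
  "cip I x y = (\<Sum>i\<in>I. x i * cnj (y i))"

definition row_mult :: "'i set \<Rightarrow> ('i \<Rightarrow> complex) \<Rightarrow> ('i \<Rightarrow> 'q \<Rightarrow> complex) \<Rightarrow> 'q \<Rightarrow> complex" where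
  "row_mult I v X q = (\<Sum>i\<in>I. v i * X i q)"

lemma sqn_nonneg [simp]: "0 \<le> sqn I x"
  by (simp add: sqn_def sum_nonneg)

lemma sqn_scale: "sqn I (\<lambda>i. c * x i) = (cmod c)\<^sup>2 * sqn I x"
  by (simp add: sqn_def norm_mult power_mult_distrib sum_distrib_left)

lemma sqn_eq_0D: "finite I \<Longrightarrow> sqn I x = 0 \<Longrightarrow> i \<in> I \<Longrightarrow> x i = 0"
  by (simp add: sqn_def sum_nonneg_eq_0_iff)

lemma cip_self: "cip I x x = complex_of_real (sqn I x)"
  unfolding sqn_def cip_def of_real_sum
  by (rule sum.cong) (simp_all add: complex_norm_square del: of_real_power)

lemma cip_commute: "cip I y x = cnj (cip I x y)"
  by (simp add: cip_def mult.commute)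

lemma cip_lincomb_left: "cip I (\<lambda>i. a * x i + b * y i) z = a * cip I x z + b * cip I y z"
  by (simp add: cip_def algebra_simps sum.distrib sum_distrib_left)

lemma cip_lincomb_right:
  "cip I z (\<lambda>i. a * x i + b * y i) = cnj a * cip I z x + cnj b * cip I z y"
  by (simp add: cip_def algebra_simps sum.distrib sum_distrib_left)

lemma cip_lincomb:
  "cip I (\<lambda>i. a * x i + b * y i) (\<lambda>i. a * x' i + b * y' i)
   = of_real ((cmod a)\<^sup>2) * cip I x x' + of_real ((cmod b)\<^sup>2) * cip I y y'
     + a * cnj b * cip I x y' + b * cnj a * cip I y x'"
  by (simp add: cip_lincomb_left cip_lincomb_right complex_norm_square algebra_simps del: of_real_power)

lemma sqn_lincomb:
  "sqn I (\<lambda>i. a * x i + b * y i)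
   = (cmod a)\<^sup>2 * sqn I x + (cmod b)\<^sup>2 * sqn I y + 2 * Re (a * cnj b * cip I x y)"
proof -
  have "sqn I (\<lambda>i. a * x i + b * y i) = Re (cip I (\<lambda>i. a * x i + b * y i) (\<lambda>i. a * x i + b * y i))"
    by (simp add: cip_self)
  also have "\<dots> = (cmod a)\<^sup>2 * sqn I x + (cmod b)\<^sup>2 * sqn I y
                   + Re (a * cnj b * cip I x y) + Re (cnj (a * cnj b * cip I x y))"
    unfolding cip_lincomb by (subst cip_commute[of I y x]) (simp add: cip_self mult.commute)
  finally show ?thesis by (simp only: cnj.sel)
qed

lemma norm_sum_mult_le: "(cmod (\<Sum>i\<in>I. x i * y i))\<^sup>2 \<le> sqn I x * sqn I y"
proof -
  have "cmod (\<Sum>i\<in>I. x i * y i) \<le> (\<Sum>i\<in>I. cmod (x i) * cmod (y i))"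
    by (rule order_trans[OF norm_sum]) (simp add: norm_mult)
  hence "(cmod (\<Sum>i\<in>I. x i * y i))\<^sup>2 \<le> (\<Sum>i\<in>I. cmod (x i) * cmod (y i))\<^sup>2"
    by (rule power_mono) simp
  also have "\<dots> \<le> sqn I x * sqn I y"
    unfolding sqn_def by (rule Cauchy_Schwarz_ineq_sum)
  finally show ?thesis .
qed

lemma norm_cip_le: "cmod (cip I x y) \<le> sqrt (sqn I x) * sqrt (sqn I y)"
proof -
  have "(cmod (cip I x y))\<^sup>2 \<le> sqn I x * sqn I y"
    using norm_sum_mult_le[of x "\<lambda>i. cnj (y i)" I] by (simp add: cip_def sqn_def)
  thus ?thesis by (simp add: real_le_rsqrt flip: real_sqrt_mult)
qed

lemma sqn_diff_ge: "(sqrt (sqn I x) - sqrt (sqn I y))\<^sup>2 \<le> sqn I (\<lambda>i. x i - y i)"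
proof -
  have "sqn I (\<lambda>i. x i - y i) = sqn I x + sqn I y - 2 * Re (cip I x y)"
    using sqn_lincomb[of I 1 x "-1" y] by simp
  moreover have "Re (cip I x y) \<le> sqrt (sqn I x) * sqrt (sqn I y)"
    using norm_cip_le[of I x y] complex_Re_le_cmod[of "cip I x y"] by linarith
  ultimately show ?thesis by (simp add: power2_diff)
qed

lemma row_mult_lincomb:
  "row_mult I (\<lambda>i. a * x i + b * y i) X q = a * row_mult I x X q + b * row_mult I y X q"
  by (simp add: row_mult_def algebra_simps sum.distrib sum_distrib_left)

text \<open>
  A matrix and its transpose have the same norm. This allows norms, which are defined by the
  action on columns, to be computed by the action on rows, where right module maps are simple.
\<close>

lemma contraction_transpose:
  assumes contr: "\<And>v. sqn I (\<lambda>i. \<Sum>j\<in>J. K i j * v j) \<le> C * sqn J v" and C: "C \<ge> 0"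
  shows "sqn J (\<lambda>j. \<Sum>i\<in>I. w i * K i j) \<le> C * sqn I w"
proof -
  define y where "y = (\<lambda>j. \<Sum>i\<in>I. w i * K i j)"
  define N where "N = sqn J y"
  have "complex_of_real N = (\<Sum>j\<in>J. (\<Sum>i\<in>I. w i * K i j) * cnj (y j))"
    by (simp add: N_def y_def cip_def flip: cip_self)
  also have "\<dots> = (\<Sum>i\<in>I. w i * (\<Sum>j\<in>J. K i j * cnj (y j)))"
    by (simp add: sum_distrib_left sum_distrib_right mult.assoc) (rule sum.swap)
  finally have eq: "complex_of_real N = \<dots>" .
  have N0: "N \<ge> 0" by (simp add: N_def)
  have "N\<^sup>2 = (cmod (complex_of_real N))\<^sup>2" by simp
  also have "\<dots> \<le> sqn I w * sqn I (\<lambda>i. \<Sum>j\<in>J. K i j * cnj (y j))"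
    unfolding eq by (rule norm_sum_mult_le)
  also have "\<dots> \<le> sqn I w * (C * N)"
    using contr[of "\<lambda>j. cnj (y j)"] by (intro mult_left_mono) (simp_all add: N_def sqn_def sum_nonneg)
  finally have "N * N \<le> (C * sqn I w) * N" by (simp add: power2_eq_square ac_simps)
  hence "N \<le> C * sqn I w"
    using N0 C by (cases "N = 0") auto
  thus ?thesis by (simp add: N_def y_def)
qed

section \<open>Rows acting on two columns\<close>

text \<open>
  Let \<open>S\<close> be the sum of the squared norms of \<open>a1\<close> and \<open>a2\<close>, let \<open>c\<close> be the modulus of their inner
  product, let \<open>N\<close> be the quantity to be bounded, and \<open>P\<close> the sum of the two cross terms
  \<open>\<parallel>a1 X2\<parallel>\<^sup>2 + \<parallel>a2 X1\<parallel>\<^sup>2\<close>. Contractivity at \<open>a1\<close> and at \<open>a2\<close> gives \<open>P + N \<le> S\<close>, and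
  contractivity at \<open>a1 - \<omega> a2\<close>, where the phase \<open>\<omega>\<close> makes the inner product nonnegative, gives
  \<open>(\<surd>N - \<surd>P)\<^sup>2 \<le> S - 2 c\<close>. Suppose \<open>N > W\<close>. Then \<open>P \<le> S - N < S - W \<le> W < N\<close>, so
  \<open>(\<surd>N - \<surd>P)\<^sup>2 > (\<surd>W - \<surd>(S - W))\<^sup>2\<close>; but the right side is at least \<open>S - 2 c\<close>, because
  \<open>c\<^sup>2 \<ge> W (S - W)\<close>.
\<close>

lemma two_column_bound:
  assumes finQ: "finite Q"
    and contr: "\<And>v. sqn Q (row_mult I v X1) + sqn Q (row_mult I v X2) \<le> sqn I v"
    and S2: "sqn I a1 + sqn I a2 \<le> 2 * W"
    and WS: "W * (sqn I a1 + sqn I a2) \<le> W\<^sup>2 + (cmod (cip I a1 a2))\<^sup>2"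
  shows "sqn Q (row_mult I a1 X1) + sqn Q (row_mult I a2 X2) \<le> W"
proof (rule ccontr)
  define S c where "S = sqn I a1 + sqn I a2" and "c = cmod (cip I a1 a2)"
  define \<omega> where "\<omega> = (if c = 0 then 1 else sgn (cip I a1 a2))"
  have om1: "cmod \<omega> = 1" by (simp add: \<omega>_def c_def norm_sgn)
  have om2: "cnj \<omega> * cip I a1 a2 = complex_of_real c"
    using complex_norm_square[of "cip I a1 a2"]
    by (auto simp: \<omega>_def c_def sgn_eq power2_eq_square field_simps)
  define N P where "N = sqn Q (row_mult I a1 X1) + sqn Q (row_mult I a2 X2)"
    and "P = sqn Q (row_mult I a1 X2) + sqn Q (row_mult I a2 X1)"
  assume "\<not> sqn Q (row_mult I a1 X1) + sqn Q (row_mult I a2 X2) \<le> W"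
  hence NW: "N > W" by (simp add: N_def)
  have SP: "P + N \<le> S"
    using contr[of a1] contr[of a2] by (simp add: S_def P_def N_def)
  define f g where "f = case_sum (row_mult I a1 X1) (\<lambda>q. \<omega> * row_mult I a2 X2 q)"
    and "g = case_sum (\<lambda>q. \<omega> * row_mult I a2 X1 q) (row_mult I a1 X2)"
  have f: "sqn (Q <+> Q) f = N"
    using finQ om1 by (simp add: sqn_def sum.Plus f_def N_def norm_mult)
  have g: "sqn (Q <+> Q) g = P"
    using finQ om1 by (simp add: sqn_def sum.Plus g_def P_def norm_mult)
  let ?v = "\<lambda>i. 1 * a1 i + (- \<omega>) * a2 i"
  have "(sqrt N - sqrt P)\<^sup>2 \<le> sqn (Q <+> Q) (\<lambda>i. f i - g i)"
    using sqn_diff_ge[of "Q <+> Q" f g] by (simp add: f g)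
  also have "\<dots> = sqn Q (row_mult I ?v X1) + sqn Q (row_mult I ?v X2)"
    unfolding row_mult_lincomb
    using finQ by (simp add: sqn_def sum.Plus f_def g_def norm_minus_commute)
  also have "\<dots> \<le> sqn I ?v" by (rule contr)
  also have "\<dots> = S - 2 * c"
    unfolding sqn_lincomb using om2 by (simp add: om1 S_def)
  finally have main: "(sqrt N - sqrt P)\<^sup>2 \<le> S - 2 * c" .
  have P0: "P \<ge> 0" by (simp add: P_def)
  have S2': "S \<le> 2 * W" and WS': "W * (S - W) \<le> c\<^sup>2" and c0: "c \<ge> 0"
    using S2 WS by (simp_all add: S_def c_def algebra_simps power2_eq_square)
  have SW: "S - W > 0" "W > 0" "S - W \<le> W" using SP P0 NW S2' by linarith+
  have "sqrt (W * (S - W)) \<le> c" using WS' c0 by (simp add: real_le_lsqrt)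
  hence "S - 2 * c \<le> (sqrt W - sqrt (S - W))\<^sup>2"
    using SW by (simp add: power2_diff real_sqrt_mult)
  moreover have "(sqrt W - sqrt (S - W))\<^sup>2 < (sqrt N - sqrt P)\<^sup>2"
  proof (rule power_strict_mono)
    have "sqrt P \<le> sqrt (S - W)" "sqrt W < sqrt N" using SP NW by auto
    thus "sqrt W - sqrt (S - W) < sqrt N - sqrt P" by linarith
    show "0 \<le> sqrt W - sqrt (S - W)" using SW by simp
  qed simp
  ultimately show False using main by linarith
qed

lemma bessel_two:
  assumes orth: "cip I b1 b2 = 0"
  shows "(cmod (cip I v b1))\<^sup>2 / sqn I b1 + (cmod (cip I v b2))\<^sup>2 / sqn I b2 \<le> sqn I v"
proof -
  define \<alpha> \<beta> where "\<alpha> = cip I v b1 / sqn I b1" and "\<beta> = cip I v b2 / sqn I b2"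
  let ?z = "\<lambda>i. \<alpha> * b1 i + \<beta> * b2 i"
  have A: "(cmod \<alpha>)\<^sup>2 * sqn I b1 = (cmod (cip I v b1))\<^sup>2 / sqn I b1"
    by (simp add: \<alpha>_def norm_divide power_divide power2_eq_square)
  have B: "(cmod \<beta>)\<^sup>2 * sqn I b2 = (cmod (cip I v b2))\<^sup>2 / sqn I b2"
    by (simp add: \<beta>_def norm_divide power_divide power2_eq_square)
  have z: "sqn I ?z = (cmod (cip I v b1))\<^sup>2 / sqn I b1 + (cmod (cip I v b2))\<^sup>2 / sqn I b2"
    unfolding sqn_lincomb by (simp add: A B orth)
  have "cip I v ?z = complex_of_real (sqn I ?z)"
    unfolding z cip_lincomb_right
    by (simp add: \<alpha>_def \<beta>_def complex_norm_square mult.commute del: of_real_power)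
  hence "0 \<le> sqn I v - sqn I ?z"
    using sqn_nonneg[of I "\<lambda>i. 1 * v i + (-1) * ?z i"] unfolding sqn_lincomb[of I 1 v "-1" ?z]
    by simp
  thus ?thesis by (simp add: z)
qed

lemma cip_scale_right: "cip I x (\<lambda>i. c * y i) = cnj c * cip I x y"
  using cip_lincomb_right[of I x c y 0 y] by simp

text \<open>
  This is the converse of \<open>two_column_bound\<close> when only single columns \<open>x1\<close>, \<open>x2\<close> are tested. The pair that attains the extremum is found in the plane
  of \<open>a1\<close> and \<open>a2\<close>, if \<open>0 < 2 c < S\<close>: with \<open>k\<close> the smaller root of \<open>k\<^sup>2 c - k S + c = 0\<close>, the vectors
  \<open>a1 - k a2\<close> and \<open>a2 - k a1\<close> are orthogonal, and their normalisations give the value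
  \<open>N = c / k\<close>. Since \<open>S = N (1 + k\<^sup>2)\<close> and \<open>c = k N\<close>, the second claim is
  \<open>0 \<le> (W - N) (W - k\<^sup>2 N)\<close>.
\<close>

lemma vector_state_bounds_real:
  assumes bound: "\<And>x1 x2. (\<And>v. (cmod (\<Sum>i\<in>I. v i * x1 i))\<^sup>2 + (cmod (\<Sum>i\<in>I. v i * x2 i))\<^sup>2 \<le> sqn I v)
        \<Longrightarrow> (cmod (\<Sum>i\<in>I. a1 i * x1 i))\<^sup>2 + (cmod (\<Sum>i\<in>I. a2 i * x2 i))\<^sup>2 \<le> W"
    and c: "cip I a1 a2 = complex_of_real c" "c \<ge> 0"
  shows "sqn I a1 + sqn I a2 \<le> 2 * W" "W * (sqn I a1 + sqn I a2) \<le> W\<^sup>2 + c\<^sup>2"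
proof -
  define S where "S = sqn I a1 + sqn I a2"
  have orth: "(cmod (cip I a1 b1))\<^sup>2 / sqn I b1 + (cmod (cip I a2 b2))\<^sup>2 / sqn I b2 \<le> W"
    if "cip I b1 b2 = 0" for b1 b2
  proof -
    define x where "x = (\<lambda>b i. cnj (b i) / complex_of_real (sqrt (sqn I b)))"
    have x: "(cmod (\<Sum>i\<in>I. v i * x b i))\<^sup>2 = (cmod (cip I v b))\<^sup>2 / sqn I b" for v b
    proof -
      have "(\<Sum>i\<in>I. v i * x b i) = cip I v b / complex_of_real (sqrt (sqn I b))"
        by (simp add: x_def cip_def sum_divide_distrib)
      thus ?thesis by (simp add: norm_divide power_divide)
    qed
    show ?thesis
      using bound[of "x b1" "x b2"] bessel_two[OF that] unfolding x by blast
  qed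
  have sq: "(cmod (cip I a a))\<^sup>2 / sqn I a = sqn I a" for a
    by (simp add: cip_self power2_eq_square)
  have z: "cip I a (\<lambda>_. 0) = 0" "cip I (\<lambda>_. 0) a = 0" for a by (simp_all add: cip_def)
  have a1: "sqn I a1 \<le> W" using orth[of a1 "\<lambda>_. 0"] unfolding sq z by simp
  have a2: "sqn I a2 \<le> W" using orth[of "\<lambda>_. 0" a2] unfolding sq z by simp
  have W: "W \<ge> 0" using a1 sqn_nonneg[of I a1] by linarith
  show S2: "sqn I a1 + sqn I a2 \<le> 2 * W" using a1 a2 by linarith
  have Sc: "2 * c \<le> S"
    using sqn_nonneg[of I "\<lambda>i. 1 * a1 i + (- 1) * a2 i"] unfolding sqn_lincomb c
    by (simp add: S_def)
  consider "c = 0" | "S = 2 * c" | "0 < c" "2 * c < S" using Sc c by linarith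
  then have "W * S \<le> W\<^sup>2 + c\<^sup>2"
  proof cases
    case 1
    hence "S \<le> W" using orth[of a1 a2] c unfolding sq S_def by simp
    thus ?thesis using W by (simp add: 1 power2_eq_square mult_left_mono)
  next
    case 2
    have "0 \<le> (W - c)\<^sup>2" by simp
    thus ?thesis by (simp add: 2 power2_diff)
  next
    case 3
    define R k N where "R = sqrt (S\<^sup>2 - (2 * c)\<^sup>2)" and "k = (S - R) / (2 * c)" and "N = c / k"
    have disc: "0 < S\<^sup>2 - (2 * c)\<^sup>2" using 3 power_strict_mono[of "2 * c" S 2] by simp
    have R2: "R\<^sup>2 = S\<^sup>2 - (2 * c)\<^sup>2" using disc by (simp add: R_def)
    have R0: "R > 0" using disc by (simp add: R_def)
    have RS: "R < S"
      by (rule power_less_imp_less_base[of _ 2]) (use 3 R2 in auto)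
    have "(S - 2 * c)\<^sup>2 < R\<^sup>2"
    proof -
      have "R\<^sup>2 - (S - 2 * c)\<^sup>2 = 4 * c * (S - 2 * c)"
        unfolding R2 by (simp add: power2_eq_square algebra_simps)
      thus ?thesis using 3 by (smt (verit) mult_pos_pos)
    qed
    hence "S - 2 * c < R" using R0 by (simp add: power_less_imp_less_base)
    hence k: "0 < k" "k < 1" using RS 3 by (simp_all add: k_def field_simps)
    have kq: "k\<^sup>2 * c - k * S + c = 0"
    proof -
      have "R = S - 2 * c * k" using 3 by (simp add: k_def)
      hence "(S - 2 * c * k)\<^sup>2 = S\<^sup>2 - (2 * c)\<^sup>2" using R2 by simp
      hence "4 * c * (k\<^sup>2 * c - k * S + c) = 0"
        by (simp add: power2_eq_square algebra_simps)
      thus ?thesis using 3 by simp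
    qed
    have cN: "c = k * N" using k by (simp add: N_def)
    have "k * (N * (1 + k\<^sup>2) - S) = 0"
      using kq by (simp add: cN algebra_simps power2_eq_square)
    hence SN: "S = N * (1 + k\<^sup>2)" using k by simp
    define b1 b2 where "b1 = (\<lambda>i. 1 * a1 i + complex_of_real (- k) * a2 i)"
      and "b2 = (\<lambda>i. complex_of_real (- k) * a1 i + 1 * a2 i)"
    have c': "cip I a2 a1 = complex_of_real c" using cip_commute[of I a2 a1] c by simp
    have "cip I b1 b2 = complex_of_real (k\<^sup>2 * c - k * S + c)"
      unfolding b1_def b2_def cip_lincomb_left cip_lincomb_right
      by (simp add: c c' cip_self S_def power2_eq_square algebra_simps)
    hence bb: "cip I b1 b2 = 0" by (simp add: kq)
    have k2: "1 - k\<^sup>2 > 0" using k by (simp add: power_less_one_iff abs_square_less_1)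
    have ratio: "(cmod (cip I a b))\<^sup>2 / sqn I b = (sqn I a - k * c) / (1 - k\<^sup>2)"
      if "cip I a b = complex_of_real (sqn I a - k * c)"
         "sqn I b = (1 - k\<^sup>2) * (sqn I a - k * c)" for a b
    proof -
      have "r\<^sup>2 / ((1 - k\<^sup>2) * r) = r / (1 - k\<^sup>2)" for r :: real
        by (simp add: power2_eq_square)
      thus ?thesis by (simp only: that norm_of_real power2_abs)
    qed
    have s1: "sqn I b1 = (1 - k\<^sup>2) * (sqn I a1 - k * c)"
    proof -
      have "sqn I b1 = sqn I a1 + k\<^sup>2 * sqn I a2 - 2 * k * c"
        unfolding b1_def sqn_lincomb by (simp add: c)
      moreover have "k * (k\<^sup>2 * c - k * S + c) = 0" by (simp add: kq)
      ultimately show ?thesis by (simp add: S_def algebra_simps power2_eq_square)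
    qed
    have s2: "sqn I b2 = (1 - k\<^sup>2) * (sqn I a2 - k * c)"
    proof -
      have "sqn I b2 = sqn I a2 + k\<^sup>2 * sqn I a1 - 2 * k * c"
        unfolding b2_def sqn_lincomb by (simp add: c)
      moreover have "k * (k\<^sup>2 * c - k * S + c) = 0" by (simp add: kq)
      ultimately show ?thesis by (simp add: S_def algebra_simps power2_eq_square)
    qed
    have "(sqn I a1 - k * c) / (1 - k\<^sup>2) + (sqn I a2 - k * c) / (1 - k\<^sup>2) \<le> W"
    proof -
      have "cip I a1 b1 = complex_of_real (sqn I a1 - k * c)"
        unfolding b1_def cip_lincomb_right by (simp add: cip_self c)
      moreover have "cip I a2 b2 = complex_of_real (sqn I a2 - k * c)"
        unfolding b2_def cip_lincomb_right by (simp add: cip_self c')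
      ultimately show ?thesis using orth[OF bb] ratio[OF _ s1] ratio[OF _ s2] by simp
    qed
    moreover have "(sqn I a1 - k * c) / (1 - k\<^sup>2) + (sqn I a2 - k * c) / (1 - k\<^sup>2)
        = (S - 2 * k * c) / (1 - k\<^sup>2)"
      by (simp add: S_def flip: add_divide_distrib)
    moreover have "S - 2 * k * c = N * (1 - k\<^sup>2)"
      by (simp add: SN cN power2_eq_square algebra_simps)
    ultimately have NW: "N \<le> W" using k2 by simp
    have N0: "N > 0" using 3 k by (simp add: N_def)
    hence "k\<^sup>2 * N \<le> 1 * N" using k2 by (intro mult_right_mono) auto
    hence "0 \<le> (W - N) * (W - k\<^sup>2 * N)" using NW by (intro mult_nonneg_nonneg) auto
    thus ?thesis by (simp add: SN cN power2_eq_square algebra_simps)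
  qed
  thus "W * (sqn I a1 + sqn I a2) \<le> W\<^sup>2 + c\<^sup>2" by (simp add: S_def)
qed

text \<open>
  The general case follows by multiplying \<open>a2\<close> with a phase that makes the inner product real
  and nonnegative.
\<close>

lemma vector_state_bounds:
  assumes bound: "\<And>x1 x2. (\<And>v. (cmod (\<Sum>i\<in>I. v i * x1 i))\<^sup>2 + (cmod (\<Sum>i\<in>I. v i * x2 i))\<^sup>2 \<le> sqn I v)
        \<Longrightarrow> (cmod (\<Sum>i\<in>I. a1 i * x1 i))\<^sup>2 + (cmod (\<Sum>i\<in>I. a2 i * x2 i))\<^sup>2 \<le> W"
  shows "sqn I a1 + sqn I a2 \<le> 2 * W"
    and "W * (sqn I a1 + sqn I a2) \<le> W\<^sup>2 + (cmod (cip I a1 a2))\<^sup>2"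
proof -
  define c where "c = cmod (cip I a1 a2)"
  define \<omega> where "\<omega> = (if c = 0 then 1 else sgn (cip I a1 a2))"
  have om1: "cmod \<omega> = 1" by (simp add: \<omega>_def c_def norm_sgn)
  have om2: "cip I a1 (\<lambda>i. \<omega> * a2 i) = complex_of_real c"
    unfolding cip_scale_right
    using complex_norm_square[of "cip I a1 a2"]
    by (auto simp: \<omega>_def c_def sgn_eq power2_eq_square field_simps)
  have c0: "c \<ge> 0" by (simp add: c_def)
  have b: "(cmod (\<Sum>i\<in>I. a1 i * x1 i))\<^sup>2 + (cmod (\<Sum>i\<in>I. \<omega> * a2 i * x2 i))\<^sup>2 \<le> W"
    if "\<And>v. (cmod (\<Sum>i\<in>I. v i * x1 i))\<^sup>2 + (cmod (\<Sum>i\<in>I. v i * x2 i))\<^sup>2 \<le> sqn I v" for x1 x2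
    using bound[OF that] by (simp add: mult.assoc norm_mult om1 flip: sum_distrib_left)
  have "sqn I (\<lambda>i. \<omega> * a2 i) = sqn I a2" by (simp add: sqn_scale om1)
  thus "sqn I a1 + sqn I a2 \<le> 2 * W"
    and "W * (sqn I a1 + sqn I a2) \<le> W\<^sup>2 + (cmod (cip I a1 a2))\<^sup>2"
    using vector_state_bounds_real[OF b om2 c0] by (simp_all add: c_def)
qed

section \<open>Replacing mixtures by single vectors\<close>

lemma rank_one_factor:
  fixes w :: complex
  assumes "0 \<le> p" "0 \<le> r" "p * r = (cmod w)\<^sup>2"
  obtains a b where "(cmod a)\<^sup>2 = p" "(cmod b)\<^sup>2 = r" "a * cnj b = w"
proof (cases "p = 0")
  case True
  thus ?thesis using assms by (intro that[of 0 "complex_of_real (sqrt r)"]) auto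
next
  case False
  show ?thesis
  proof (rule that)
    show "(cmod (complex_of_real (sqrt p)))\<^sup>2 = p" using assms by simp
    show "(cmod (cnj w / complex_of_real (sqrt p)))\<^sup>2 = r"
      using assms False by (simp add: norm_divide power_divide field_simps)
    show "complex_of_real (sqrt p) * cnj (cnj w / complex_of_real (sqrt p)) = w"
      using False assms by simp
  qed
qed

text \<open>
  Start at the identity matrix and move along an indefinite Hermitian \<open>2 \<times> 2\<close> matrix with
  diagonal \<open>d1\<close>, \<open>d2\<close> and off-diagonal entry \<open>w\<close>. The boundary of the positive cone is reached
  at \<open>t = - 1 / l\<close>, where \<open>l < 0\<close> is the smaller eigenvalue, and there the matrix has rank one.
\<close>

lemma rank_one_on_ray:
  fixes w :: complex and d1 d2 :: real
  assumes indef: "d1 * d2 < (cmod w)\<^sup>2"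
  obtains t a b where "t > 0" "(cmod a)\<^sup>2 = 1 + t * d1" "(cmod b)\<^sup>2 = 1 + t * d2"
    "a * cnj b = complex_of_real t * w"
proof -
  define disc where "disc = (d1 - d2)\<^sup>2 + 4 * (cmod w)\<^sup>2"
  define l where "l = (d1 + d2 - sqrt disc) / 2"
  have "(d1 + d2)\<^sup>2 < disc"
    using indef by (simp add: disc_def power2_eq_square algebra_simps)
  hence "\<bar>d1 + d2\<bar> < sqrt disc" by (simp add: real_less_rsqrt)
  hence l: "l < 0" by (simp add: l_def)
  have "\<bar>d1 - d2\<bar> \<le> sqrt disc" by (rule real_le_rsqrt) (simp add: disc_def)
  hence d: "d1 - l \<ge> 0" "d2 - l \<ge> 0" by (simp_all add: l_def field_simps)
  have "(sqrt disc)\<^sup>2 = disc" by (simp add: disc_def)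
  hence ch: "(d1 - l) * (d2 - l) = (cmod w)\<^sup>2"
    by (simp add: l_def disc_def power2_eq_square field_simps)
  define t where "t = - 1 / l"
  have t: "t > 0" using l by (simp add: t_def)
  have e: "1 + t * d1 = t * (d1 - l)" "1 + t * d2 = t * (d2 - l)"
    using l by (simp_all add: t_def field_simps)
  have "0 \<le> 1 + t * d1" "0 \<le> 1 + t * d2" unfolding e using t d by simp_all
  moreover have "(1 + t * d1) * (1 + t * d2) = (cmod (complex_of_real t * w))\<^sup>2"
  proof -
    have "(1 + t * d1) * (1 + t * d2) = t\<^sup>2 * ((d1 - l) * (d2 - l))"
      unfolding e by (simp add: power2_eq_square)
    thus ?thesis unfolding ch by (simp add: norm_mult power_mult_distrib)
  qed
  ultimately show ?thesis using rank_one_factor t that by metis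
qed

text \<open>
  A semidefinite nonzero matrix has a nonzero trace product with a positive definite one. For
  \<open>2 \<times> 2\<close> matrices this is the inequality between the arithmetic and the geometric mean.
\<close>

lemma indefinite_if_orthogonal_to_definite:
  fixes w g12 :: complex
  assumes nz: "d1 \<noteq> 0 \<or> d2 \<noteq> 0 \<or> w \<noteq> 0"
    and eq: "d1 * g1 + d2 * g2 + 2 * Re (w * g12) = 0"
    and pd: "(cmod g12)\<^sup>2 < g1 * g2" "g1 > 0"
  shows "d1 * d2 < (cmod w)\<^sup>2"
proof (rule ccontr)
  assume "\<not> d1 * d2 < (cmod w)\<^sup>2"
  hence le: "(cmod w)\<^sup>2 \<le> d1 * d2" by simp
  have gg: "g1 * g2 > 0" using pd by (smt (verit) zero_le_power2)
  hence g2: "g2 > 0" using pd by (simp add: zero_less_mult_iff)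
  show False
  proof (cases "w = 0")
    case True
    hence "d1 * g1 + d2 * g2 = 0" "0 \<le> d1 * d2" using eq le by simp_all
    hence *: "d1 * g1 = - (d2 * g2)" by simp
    have "d1\<^sup>2 * g1 = d1 * (d1 * g1)" by (simp add: power2_eq_square)
    also have "\<dots> = - ((d1 * d2) * g2)" unfolding * by simp
    also have "\<dots> \<le> 0" using \<open>0 \<le> d1 * d2\<close> g2 by simp
    finally have "d1 = 0" using pd by (simp add: mult_le_0_iff)
    thus False using * g2 nz True by simp
  next
    case False
    have "(2 * Re (w * g12))\<^sup>2 \<le> (2 * cmod (w * g12))\<^sup>2"
      using abs_Re_le_cmod[of "w * g12"] by (intro power2_le_iff_abs_le[THEN iffD2]) auto
    also have "\<dots> = 4 * ((cmod w)\<^sup>2 * (cmod g12)\<^sup>2)"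
      by (simp add: norm_mult power_mult_distrib)
    also have "\<dots> < 4 * ((cmod w)\<^sup>2 * (g1 * g2))" using False pd by simp
    also have "\<dots> \<le> 4 * ((d1 * d2) * (g1 * g2))"
      using le gg by (intro mult_left_mono mult_right_mono) auto
    also have "\<dots> \<le> (d1 * g1 + d2 * g2)\<^sup>2"
      using zero_le_power2[of "d1 * g1 - d2 * g2"] by (simp add: power2_eq_square algebra_simps)
    also have "(d1 * g1 + d2 * g2)\<^sup>2 = (2 * Re (w * g12))\<^sup>2"
    proof -
      have "d1 * g1 + d2 * g2 = - (2 * Re (w * g12))" using eq by linarith
      thus ?thesis by (simp only: power2_minus)
    qed
    finally show False by simp
  qed
qed

text \<open>
  The Hermitian \<open>2 \<times> 2\<close> matrices form a real space of dimension four, so three linear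
  conditions have a common nonzero solution.
\<close>

lemma hermitian_orthogonal_exists:
  fixes g12 p12 q12 :: complex and g1 g2 p1 p2 q1 q2 :: real
  obtains d1 d2 w where "d1 \<noteq> 0 \<or> d2 \<noteq> 0 \<or> w \<noteq> (0::complex)"
    "d1 * g1 + d2 * g2 + 2 * Re (w * g12) = 0"
    "d1 * p1 + d2 * p2 + 2 * Re (w * p12) = 0"
    "d1 * q1 + d2 * q2 + 2 * Re (w * q12) = 0"
proof -
  define B where "B = {(g1, g2, 2 * cnj g12), (p1, p2, 2 * cnj p12), (q1, q2, 2 * cnj q12)}"
  have "dim B \<le> card B" by (rule dim_le_card') (simp add: B_def)
  also have "\<dots> \<le> 3" unfolding B_def by (rule card_insert_le_m1; simp)+
  finally have "dim B < DIM(real \<times> real \<times> complex)" by simp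
  then obtain d where d: "d \<noteq> 0" "\<And>y. y \<in> span B \<Longrightarrow> orthogonal d y"
    using orthogonal_to_subspace_exists by blast
  obtain d1 d2 w where dd: "d = (d1, d2, w)" by (cases d) auto
  have "inner d y = 0" if "y \<in> B" for y
    using d(2)[OF span_base[OF that]] by (simp add: orthogonal_def)
  from this[of "(g1, g2, 2 * cnj g12)"] this[of "(p1, p2, 2 * cnj p12)"]
    this[of "(q1, q2, 2 * cnj q12)"]
  have "d1 * g1 + d2 * g2 + 2 * Re (w * g12) = 0"
    "d1 * p1 + d2 * p2 + 2 * Re (w * p12) = 0"
    "d1 * q1 + d2 * q2 + 2 * Re (w * q12) = 0"
    by (simp_all add: B_def dd inner_complex_def inner_prod_def algebra_simps)
  moreover have "d1 \<noteq> 0 \<or> d2 \<noteq> 0 \<or> w \<noteq> 0" using d(1) by (auto simp: dd zero_prod_def)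
  ultimately show ?thesis using that by blast
qed

text \<open>
  Here \<open>(g1, g2, g12)\<close> and \<open>(h1, h2, h12)\<close> are Hermitian forms on the plane spanned by two
  vectors and \<open>(b1, b2, b12, b21)\<close> is an arbitrary sesquilinear form. Preserving the first form and
  the real and imaginary parts of the last one costs three real conditions, so there is a
  Hermitian direction that meets them; its sign is chosen such that the second form does not
  decrease, and one moves along it from the identity until the rank drops to one.
\<close>

lemma merge_forms:
  fixes g1 g2 h1 h2 :: real and g12 h12 b1 b2 b12 b21 :: complex
  assumes pd: "(cmod g12)\<^sup>2 < g1 * g2" "g1 > 0"
  obtains a b where
    "(cmod a)\<^sup>2 * g1 + (cmod b)\<^sup>2 * g2 + 2 * Re (a * cnj b * g12) = g1 + g2"
    "of_real ((cmod a)\<^sup>2) * b1 + of_real ((cmod b)\<^sup>2) * b2 + a * cnj b * b12 + b * cnj a * b21 = b1 + b2"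
    "(cmod a)\<^sup>2 * h1 + (cmod b)\<^sup>2 * h2 + 2 * Re (a * cnj b * h12) \<ge> h1 + h2"
proof -
  define p12 where "p12 = (b12 + cnj b21) / 2"
  define q12 where "q12 = - (\<i> * (b12 - cnj b21)) / 2"
  obtain d1' d2' w' where d': "d1' \<noteq> 0 \<or> d2' \<noteq> 0 \<or> w' \<noteq> 0"
    "d1' * g1 + d2' * g2 + 2 * Re (w' * g12) = 0"
    "d1' * Re b1 + d2' * Re b2 + 2 * Re (w' * p12) = 0"
    "d1' * Im b1 + d2' * Im b2 + 2 * Re (w' * q12) = 0"
    by (rule hermitian_orthogonal_exists)
  define \<epsilon> :: real where "\<epsilon> = (if d1' * h1 + d2' * h2 + 2 * Re (w' * h12) \<ge> 0 then 1 else - 1)"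
  define d1 d2 w where "d1 = \<epsilon> * d1'" and "d2 = \<epsilon> * d2'" and "w = complex_of_real \<epsilon> * w'"
  have lin: "d1 * x1 + d2 * x2 + 2 * Re (w * x12)
      = \<epsilon> * (d1' * x1 + d2' * x2 + 2 * Re (w' * x12))" for x1 x2 x12
    by (simp add: d1_def d2_def w_def algebra_simps)
  have d: "d1 \<noteq> 0 \<or> d2 \<noteq> 0 \<or> w \<noteq> 0"
    "d1 * g1 + d2 * g2 + 2 * Re (w * g12) = 0"
    "d1 * Re b1 + d2 * Re b2 + 2 * Re (w * p12) = 0"
    "d1 * Im b1 + d2 * Im b2 + 2 * Re (w * q12) = 0"
    unfolding lin d' using d'(1) by (auto simp: d1_def d2_def w_def \<epsilon>_def split: if_splits)
  have h: "d1 * h1 + d2 * h2 + 2 * Re (w * h12) \<ge> 0"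
    unfolding lin by (simp add: \<epsilon>_def)
  obtain t a b where t: "t > 0" and a: "(cmod a)\<^sup>2 = 1 + t * d1" and b: "(cmod b)\<^sup>2 = 1 + t * d2"
    and ab: "a * cnj b = complex_of_real t * w"
    using rank_one_on_ray[OF indefinite_if_orthogonal_to_definite[OF d(1,2) pd]] by metis
  have shift: "(cmod a)\<^sup>2 * x1 + (cmod b)\<^sup>2 * x2 + 2 * Re (a * cnj b * x12)
      = x1 + x2 + t * (d1 * x1 + d2 * x2 + 2 * Re (w * x12))" for x1 x2 x12
    unfolding a b ab by (simp add: algebra_simps)
  have p12: "2 * Re (v * p12) = Re (v * (b12 + cnj b21))" for v
    by (simp add: p12_def field_simps)
  have q12: "2 * Re (v * q12) = Im (v * (b12 - cnj b21))" for v
    by (simp add: q12_def field_simps)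
  have ba: "b * cnj a = cnj (a * cnj b)" by simp
  show ?thesis
  proof (rule that)
    show "(cmod a)\<^sup>2 * g1 + (cmod b)\<^sup>2 * g2 + 2 * Re (a * cnj b * g12) = g1 + g2"
      unfolding shift d by simp
    show "(cmod a)\<^sup>2 * h1 + (cmod b)\<^sup>2 * h2 + 2 * Re (a * cnj b * h12) \<ge> h1 + h2"
      unfolding shift using h t by simp
    show "of_real ((cmod a)\<^sup>2) * b1 + of_real ((cmod b)\<^sup>2) * b2 + a * cnj b * b12 + b * cnj a * b21 = b1 + b2"
      (is "?l = _")
    proof (rule complex_eqI)
      have "Re ?l = (cmod a)\<^sup>2 * Re b1 + (cmod b)\<^sup>2 * Re b2 + 2 * Re (a * cnj b * p12)"
        unfolding ba p12 by (simp add: algebra_simps)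
      thus "Re ?l = Re (b1 + b2)" unfolding shift d by simp
      have "Im ?l = (cmod a)\<^sup>2 * Im b1 + (cmod b)\<^sup>2 * Im b2 + 2 * Re (a * cnj b * q12)"
        unfolding ba q12 by (simp add: algebra_simps)
      thus "Im ?l = Im (b1 + b2)" unfolding shift d by simp
    qed
  qed
qed

text \<open>
  Only independent \<open>x\<close> and \<open>y\<close> have a definite Gram matrix. For dependent ones, a multiple of one
  of them already has all the required values exactly.
\<close>

lemma merge_vectors:
  assumes fin: "finite I"
  obtains z where "sqn I z = sqn I x + sqn I y"
    "cip K (row_mult I z L1) (row_mult I z L2)
       = cip K (row_mult I x L1) (row_mult I x L2) + cip K (row_mult I y L1) (row_mult I y L2)"
    "sqn K (row_mult I z L1) + sqn K (row_mult I z L2)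
       \<ge> sqn K (row_mult I x L1) + sqn K (row_mult I x L2)
         + (sqn K (row_mult I y L1) + sqn K (row_mult I y L2))"
proof -
  consider (zero) "sqn I x = 0" | (dep) "sqn I x > 0" "sqn I x * sqn I y \<le> (cmod (cip I x y))\<^sup>2"
    | (indep) "sqn I x > 0" "(cmod (cip I x y))\<^sup>2 < sqn I x * sqn I y"
    using sqn_nonneg[of I x] by linarith
  then show ?thesis
  proof cases
    case zero
    have "row_mult I x L = (\<lambda>_. 0)" for L :: "'a \<Rightarrow> 'b \<Rightarrow> complex"
      using sqn_eq_0D[OF fin zero] by (intro ext) (simp add: row_mult_def)
    thus ?thesis using zero by (intro that[of y]) (simp_all add: cip_def sqn_def)
  next
    case dep
    define d where "d = cip I y x / complex_of_real (sqn I x)"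
    have "sqn I (\<lambda>i. 1 * y i + (- d) * x i)
        = sqn I y + (cmod d)\<^sup>2 * sqn I x - 2 * Re (cnj d * cip I y x)"
      unfolding sqn_lincomb by simp
    also have "cnj d * cip I y x = complex_of_real ((cmod (cip I y x))\<^sup>2 / sqn I x)"
      by (simp add: d_def complex_norm_square mult.commute del: of_real_power)
    also have "(cmod d)\<^sup>2 * sqn I x = (cmod (cip I y x))\<^sup>2 / sqn I x"
      by (simp add: d_def norm_divide power_divide power2_eq_square)
    also have "cmod (cip I y x) = cmod (cip I x y)"
      by (subst cip_commute) simp
    finally have "sqn I (\<lambda>i. 1 * y i + (- d) * x i) = sqn I y - (cmod (cip I x y))\<^sup>2 / sqn I x"
      by simp
    also have "\<dots> \<le> 0" using dep by (simp add: field_simps)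
    finally have "sqn I (\<lambda>i. 1 * y i + (- d) * x i) = 0"
      using sqn_nonneg[of I "\<lambda>i. 1 * y i + (- d) * x i"] by linarith
    hence y: "y i = d * x i" if "i \<in> I" for i using sqn_eq_0D[OF fin _ that] by fastforce
    have sy: "sqn I y = (cmod d)\<^sup>2 * sqn I x"
    proof -
      have "sqn I y = sqn I (\<lambda>i. d * x i)" using y by (simp add: sqn_def)
      thus ?thesis by (simp only: sqn_scale)
    qed
    have ry: "row_mult I y L = (\<lambda>q. d * row_mult I x L q)" for L :: "'a \<Rightarrow> 'b \<Rightarrow> complex"
      using y by (intro ext) (simp add: row_mult_def sum_distrib_left mult.assoc)
    define r where "r = complex_of_real (sqrt (1 + (cmod d)\<^sup>2))"
    have r: "(cmod r)\<^sup>2 = 1 + (cmod d)\<^sup>2" unfolding r_def by simp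
    have rz: "row_mult I (\<lambda>i. r * x i) L = (\<lambda>q. r * row_mult I x L q)" for L :: "'a \<Rightarrow> 'b \<Rightarrow> complex"
      by (intro ext) (simp add: row_mult_def sum_distrib_left mult.assoc)
    have cs: "cip K (\<lambda>q. e * u q) (\<lambda>q. e * v q) = complex_of_real ((cmod e)\<^sup>2) * cip K u v" for e u v
      using cip_lincomb[of K e u 0 u v v] by simp
    show ?thesis
      by (rule that[of "\<lambda>i. r * x i"])
        (simp_all only: sqn_scale sy ry rz cs r, simp_all add: algebra_simps)
  next
    case indep
    obtain a b where ab:
      "(cmod a)\<^sup>2 * sqn I x + (cmod b)\<^sup>2 * sqn I y + 2 * Re (a * cnj b * cip I x y) = sqn I x + sqn I y"
      "of_real ((cmod a)\<^sup>2) * cip K (row_mult I x L1) (row_mult I x L2)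
        + of_real ((cmod b)\<^sup>2) * cip K (row_mult I y L1) (row_mult I y L2)
        + a * cnj b * cip K (row_mult I x L1) (row_mult I y L2)
        + b * cnj a * cip K (row_mult I y L1) (row_mult I x L2)
       = cip K (row_mult I x L1) (row_mult I x L2) + cip K (row_mult I y L1) (row_mult I y L2)"
      "(cmod a)\<^sup>2 * (sqn K (row_mult I x L1) + sqn K (row_mult I x L2))
        + (cmod b)\<^sup>2 * (sqn K (row_mult I y L1) + sqn K (row_mult I y L2))
        + 2 * Re (a * cnj b * (cip K (row_mult I x L1) (row_mult I y L1)
                               + cip K (row_mult I x L2) (row_mult I y L2)))
       \<ge> sqn K (row_mult I x L1) + sqn K (row_mult I x L2)
         + (sqn K (row_mult I y L1) + sqn K (row_mult I y L2))"
      by (rule merge_forms[OF indep(2,1)])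
    have rz: "row_mult I (\<lambda>i. a * x i + b * y i) L
        = (\<lambda>q. a * row_mult I x L q + b * row_mult I y L q)" for L :: "'a \<Rightarrow> 'b \<Rightarrow> complex"
      by (rule ext) (rule row_mult_lincomb)
    show ?thesis
    proof (rule that[of "\<lambda>i. a * x i + b * y i"], unfold rz)
      show "sqn I (\<lambda>i. a * x i + b * y i) = sqn I x + sqn I y"
        unfolding sqn_lincomb by (rule ab)
    next
      show "cip K (\<lambda>q. a * row_mult I x L1 q + b * row_mult I y L1 q)
              (\<lambda>q. a * row_mult I x L2 q + b * row_mult I y L2 q)
          = cip K (row_mult I x L1) (row_mult I x L2) + cip K (row_mult I y L1) (row_mult I y L2)"
        unfolding cip_lincomb by (rule ab)
    next
      show "sqn K (row_mult I x L1) + sqn K (row_mult I x L2)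
         + (sqn K (row_mult I y L1) + sqn K (row_mult I y L2))
        \<le> sqn K (\<lambda>q. a * row_mult I x L1 q + b * row_mult I y L1 q)
          + sqn K (\<lambda>q. a * row_mult I x L2 q + b * row_mult I y L2 q)"
        unfolding sqn_lincomb by (rule order_trans[OF ab(3)]) (simp add: algebra_simps)
    qed
  qed
qed

text \<open>
  Merge the vectors of a mixture (a density matrix) pairwise into one. The last conjunct cannot be
  an equality in general: the joint numerical range of three Hermitian forms need not be convex in
  dimension two, where it is the surface of an ellipsoid, and one has to move up to the surface.
\<close>

lemma pure_state_dominates_mixture:
  assumes fin: "finite I" and "finite A"
  shows "\<exists>z. sqn I z = (\<Sum>p\<in>A. sqn I (\<psi> p)) \<and>
    cip K (row_mult I z L1) (row_mult I z L2)
      = (\<Sum>p\<in>A. cip K (row_mult I (\<psi> p) L1) (row_mult I (\<psi> p) L2)) \<and>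
    (\<Sum>p\<in>A. sqn K (row_mult I (\<psi> p) L1) + sqn K (row_mult I (\<psi> p) L2))
      \<le> sqn K (row_mult I z L1) + sqn K (row_mult I z L2)"
  using \<open>finite A\<close>
proof induction
  case empty
  show ?case
    by (rule exI[of _ "\<lambda>_. 0"]) (simp add: sqn_def cip_def row_mult_def)
next
  case (insert p A)
  then obtain z where z: "sqn I z = (\<Sum>p\<in>A. sqn I (\<psi> p))"
    "cip K (row_mult I z L1) (row_mult I z L2)
      = (\<Sum>p\<in>A. cip K (row_mult I (\<psi> p) L1) (row_mult I (\<psi> p) L2))"
    "(\<Sum>p\<in>A. sqn K (row_mult I (\<psi> p) L1) + sqn K (row_mult I (\<psi> p) L2))
      \<le> sqn K (row_mult I z L1) + sqn K (row_mult I z L2)" by blast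
  show ?case
    by (rule merge_vectors[OF fin, where x = "\<psi> p" and y = z and K = K and ?L1.0 = L1 and ?L2.0 = L2])
      (rule exI, use insert(1,2) z in \<open>auto intro: order_trans[OF add_left_mono]\<close>)
qed

section \<open>Amplification of columnwise maps\<close>

definition contraction :: "'i set \<Rightarrow> 'j set \<Rightarrow> ('i \<Rightarrow> 'j \<Rightarrow> complex) \<Rightarrow> bool" where
  "contraction I J x \<longleftrightarrow> (\<forall>v. sqn J (row_mult I v x) \<le> sqn I v)"

text \<open>
  Amplifying only the columns does not increase the norm. In each block \<open>X j\<close>, the vector \<open>u j\<close>
  norms the row that \<open>w\<close> produces from the \<open>j\<close>-th block of the image. Replacing \<open>X j\<close> by the
  single column \<open>x j = X j u j\<close> multiplies \<open>X\<close> from the right by a contraction, hence leaves a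
  contraction, and keeps the contribution of every \<open>j\<close> to the image of \<open>w\<close>.
\<close>

lemma row_amplification_bound:
  assumes H: "\<And>x w. contraction K J x \<Longrightarrow>
        sqn J (\<lambda>j. \<Sum>k\<in>K. row_mult I w (L j) k * x k j) \<le> sqn I w"
    and contr: "\<And>v. (\<Sum>j\<in>J. sqn Q (row_mult K v (X j))) \<le> sqn K v"
  shows "(\<Sum>j\<in>J. sqn Q (row_mult K (row_mult I w (L j)) (X j))) \<le> sqn I w"
proof -
  define r where "r = (\<lambda>j. row_mult K (row_mult I w (L j)) (X j))"
  have r: "row_mult K (row_mult I w (L j)) (X j) = r j" for j by (simp add: r_def)
  define u where "u = (\<lambda>j q. cnj (r j q) / complex_of_real (sqrt (sqn Q (r j))))"
  define x where "x = (\<lambda>k j. \<Sum>q\<in>Q. X j k q * u j q)"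
  have u: "sqn Q (u j) \<le> 1" for j
  proof -
    have "sqn Q (u j) = (\<Sum>q\<in>Q. (cmod (r j q))\<^sup>2 / sqn Q (r j))"
      by (subst sqn_def) (simp add: u_def norm_divide power_divide)
    also have "\<dots> = sqn Q (r j) / sqn Q (r j)"
      by (simp add: sqn_def flip: sum_divide_distrib)
    finally show ?thesis by simp
  qed
  have vx: "(\<Sum>k\<in>K. v k * x k j) = (\<Sum>q\<in>Q. row_mult K v (X j) q * u j q)" for v j
    unfolding x_def row_mult_def sum_distrib_left sum_distrib_right
    by (subst sum.swap) (simp add: mult.assoc)
  have "contraction K J x"
    unfolding contraction_def
  proof
    fix v
    have "sqn J (row_mult K v x) = (\<Sum>j\<in>J. (cmod (\<Sum>q\<in>Q. row_mult K v (X j) q * u j q))\<^sup>2)"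
      by (simp add: sqn_def row_mult_def[of K v x] vx)
    also have "\<dots> \<le> (\<Sum>j\<in>J. sqn Q (row_mult K v (X j)) * sqn Q (u j))"
      by (intro sum_mono norm_sum_mult_le)
    also have "\<dots> \<le> (\<Sum>j\<in>J. sqn Q (row_mult K v (X j)))"
      using u by (intro sum_mono mult_left_le) auto
    also have "\<dots> \<le> sqn K v" by (rule contr)
    finally show "sqn J (row_mult K v x) \<le> sqn K v" .
  qed
  hence "sqn J (\<lambda>j. \<Sum>k\<in>K. row_mult I w (L j) k * x k j) \<le> sqn I w" by (rule H)
  moreover have "(cmod (\<Sum>k\<in>K. row_mult I w (L j) k * x k j))\<^sup>2 = sqn Q (r j)" for j
  proof -
    have "(\<Sum>k\<in>K. row_mult I w (L j) k * x k j)
        = cip Q (r j) (r j) / complex_of_real (sqrt (sqn Q (r j)))"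
      unfolding vx r by (simp add: u_def cip_def sum_divide_distrib)
    also have "\<dots> = complex_of_real (sqrt (sqn Q (r j)))"
      unfolding cip_self by (simp add: real_div_sqrt flip: of_real_divide)
    finally show ?thesis by simp
  qed
  ultimately show ?thesis by (simp add: sqn_def[of J] r_def)
qed

lemma sqn_Times: "sqn (A \<times> B) v = (\<Sum>p\<in>A. sqn B (\<lambda>i. v (p, i)))"
  by (simp add: sqn_def sum.cartesian_product)

lemma sqn_Times': "sqn (A \<times> B) v = (\<Sum>i\<in>B. sqn A (\<lambda>p. v (p, i)))"
  unfolding sqn_Times by (simp add: sqn_def) (rule sum.swap)

text \<open>
  In a row vector indexed by \<open>P \<times> I\<close>, the first component numbers the copies of the row space,
  on each of which \<open>L\<close> acts in the same way.
\<close>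

definition amplified_row ::
  "'i set \<Rightarrow> ('p \<times> 'i \<Rightarrow> complex) \<Rightarrow> ('i \<Rightarrow> 'k \<Rightarrow> complex) \<Rightarrow> 'p \<times> 'k \<Rightarrow> complex" where
  "amplified_row I w L = (\<lambda>(p, k). row_mult I (\<lambda>i. w (p, i)) L k)"

text \<open>
  Write the row vector \<open>w\<close> as the sum over \<open>i\<close> of \<open>n i\<close> times the tensor product of a vector \<open>f i\<close>
  of norm at most one with the \<open>i\<close>-th unit vector. By the Cauchy-Schwarz inequality the square of
  the sum over \<open>i\<close> costs the factor \<open>\<Sum>i. (n i)\<^sup>2 = \<parallel>w\<parallel>\<^sup>2\<close>. Each of the
  remaining \<open>card I\<close> terms is at most one, because compressing the blocks of \<open>X\<close> with \<open>f i\<close>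
  leaves a contraction in which only the columns are amplified.
\<close>

lemma amplification_bound_card:
  fixes I :: "'i set" and K :: "'k set" and P :: "'p set" and Q :: "'q set"
  assumes finI: "finite I" and finP: "finite P"
    and H: "\<And>x w. contraction K J x \<Longrightarrow>
        sqn J (\<lambda>j. \<Sum>k\<in>K. row_mult I w (L j) k * x k j) \<le> sqn I w"
    and contr: "\<And>v. (\<Sum>j\<in>J. sqn Q (row_mult (P \<times> K) v (X j))) \<le> sqn (P \<times> K) v"
  shows "(\<Sum>j\<in>J. sqn Q (row_mult (P \<times> K) (amplified_row I w (L j)) (X j)))
      \<le> real (card I) * sqn (P \<times> I) w"
proof -
  define n where "n = (\<lambda>i. sqrt (sqn P (\<lambda>p. w (p, i))))"
  define f where "f = (\<lambda>i p. w (p, i) / complex_of_real (n i))"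
  have w: "w (p, i) = complex_of_real (n i) * f i p" if "p \<in> P" for p i
  proof (cases "n i = 0")
    case True
    hence "sqn P (\<lambda>p. w (p, i)) = 0" by (simp add: n_def)
    from sqn_eq_0D[OF finP this that] show ?thesis by (simp add: True)
  qed (simp add: f_def)
  have f: "sqn P (f i) \<le> 1" for i
  proof -
    have "sqn P (f i) = (\<Sum>p\<in>P. (cmod (w (p, i)))\<^sup>2 / (n i)\<^sup>2)"
      unfolding sqn_def f_def by (simp add: norm_divide power_divide)
    also have "\<dots> = sqn P (\<lambda>p. w (p, i)) / (n i)\<^sup>2"
      by (simp add: sqn_def flip: sum_divide_distrib)
    finally show ?thesis by (simp add: n_def)
  qed
  define e where "e = (\<lambda>i i' :: 'i. if i' = i then 1 else 0 :: complex)"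
  have e: "row_mult I (e i) L = L i" if "i \<in> I" for i and L :: "'i \<Rightarrow> 'k \<Rightarrow> complex"
    using finI that by (simp add: row_mult_def e_def fun_eq_iff if_distribR sum.delta if_distrib cong: if_cong)
  have e1: "sqn I (e i) = 1" if "i \<in> I" for i
  proof -
    have "sqn I (e i) = (\<Sum>i'\<in>I. if i' = i then 1 else 0)"
      unfolding sqn_def e_def by (rule sum.cong) auto
    thus ?thesis using finI that by simp
  qed
  define Y where "Y = (\<lambda>i j k q. \<Sum>p\<in>P. f i p * X j (p, k) q)"
  have rowY: "row_mult K v (Y i j) q = row_mult (P \<times> K) (\<lambda>(p, k). f i p * v k) (X j) q" for v i j q
    unfolding row_mult_def Y_def sum_distrib_left
    by (subst sum.swap) (simp add: sum.cartesian_product algebra_simps case_prod_unfold)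
  have each: "(\<Sum>j\<in>J. sqn Q (row_mult K (L j i) (Y i j))) \<le> 1" if "i \<in> I" for i
  proof -
    have "(\<Sum>j\<in>J. sqn Q (row_mult K (row_mult I (e i) (L j)) (Y i j))) \<le> sqn I (e i)"
    proof (rule row_amplification_bound[OF H])
      fix v
      have "(\<Sum>j\<in>J. sqn Q (row_mult K v (Y i j)))
          = (\<Sum>j\<in>J. sqn Q (row_mult (P \<times> K) (\<lambda>(p, k). f i p * v k) (X j)))"
        by (simp add: sqn_def rowY)
      also have "\<dots> \<le> sqn (P \<times> K) (\<lambda>(p, k). f i p * v k)" by (rule contr)
      also have "\<dots> = sqn P (f i) * sqn K v"
        unfolding sqn_Times by (simp add: sqn_scale) (simp add: sqn_def sum_distrib_right)
      also have "\<dots> \<le> sqn K v" using f[of i] by (simp add: mult_left_le_one_le)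
      finally show "(\<Sum>j\<in>J. sqn Q (row_mult K v (Y i j))) \<le> sqn K v" .
    qed
    thus ?thesis using that by (simp add: e e1)
  qed
  have decomp: "row_mult (P \<times> K) (amplified_row I w (L j)) (X j) q
      = (\<Sum>i\<in>I. complex_of_real (n i) * row_mult K (L j i) (Y i j) q)" for j q
  proof -
    have "row_mult (P \<times> K) (amplified_row I w (L j)) (X j) q
        = (\<Sum>p\<in>P. \<Sum>k\<in>K. \<Sum>i\<in>I. w (p, i) * L j i k * X j (p, k) q)"
    proof -
      have "row_mult (P \<times> K) (amplified_row I w (L j)) (X j) q
          = (\<Sum>p\<in>P. \<Sum>k\<in>K. amplified_row I w (L j) (p, k) * X j (p, k) q)"
        by (simp add: row_mult_def sum.cartesian_product)
      thus ?thesis by (simp add: amplified_row_def row_mult_def sum_distrib_right)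
    qed
    also have "\<dots> = (\<Sum>p\<in>P. \<Sum>k\<in>K. \<Sum>i\<in>I. complex_of_real (n i) * (f i p * L j i k * X j (p, k) q))"
      by (intro sum.cong refl) (simp add: w mult.assoc)
    also have "\<dots> = (\<Sum>p\<in>P. \<Sum>i\<in>I. \<Sum>k\<in>K. complex_of_real (n i) * (f i p * L j i k * X j (p, k) q))"
      by (intro sum.cong refl sum.swap)
    also have "\<dots> = (\<Sum>i\<in>I. \<Sum>p\<in>P. \<Sum>k\<in>K. complex_of_real (n i) * (f i p * L j i k * X j (p, k) q))"
      by (rule sum.swap)
    also have "\<dots> = (\<Sum>i\<in>I. complex_of_real (n i) * row_mult K (L j i) (Y i j) q)"
      unfolding rowY by (simp add: row_mult_def sum.cartesian_product case_prod_unfold sum_distrib_left)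
    finally show ?thesis .
  qed
  have wn: "sqn (P \<times> I) w = sqn I (\<lambda>i. complex_of_real (n i))"
    unfolding sqn_Times' by (simp add: sqn_def[of I] n_def)
  have "(\<Sum>j\<in>J. sqn Q (row_mult (P \<times> K) (amplified_row I w (L j)) (X j)))
      \<le> (\<Sum>j\<in>J. \<Sum>q\<in>Q. sqn (P \<times> I) w * sqn I (\<lambda>i. row_mult K (L j i) (Y i j) q))"
    unfolding sqn_def[of Q] decomp wn by (intro sum_mono norm_sum_mult_le)
  also have "\<dots> = sqn (P \<times> I) w * (\<Sum>j\<in>J. \<Sum>q\<in>Q. \<Sum>i\<in>I. (cmod (row_mult K (L j i) (Y i j) q))\<^sup>2)"
    by (simp add: sum_distrib_left sqn_def[of I])
  also have "(\<Sum>j\<in>J. \<Sum>q\<in>Q. \<Sum>i\<in>I. (cmod (row_mult K (L j i) (Y i j) q))\<^sup>2)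
      = (\<Sum>i\<in>I. \<Sum>j\<in>J. sqn Q (row_mult K (L j i) (Y i j)))"
    unfolding sqn_def by (subst sum.swap[of _ I]) (intro sum.cong refl sum.swap)
  also have "sqn (P \<times> I) w * \<dots> \<le> sqn (P \<times> I) w * (\<Sum>i\<in>I. 1)"
    by (intro mult_left_mono sum_mono each) simp_all
  finally show ?thesis by (simp add: mult.commute)
qed

text \<open>
  On two columns the completely bounded norm equals the norm. The row \<open>w\<close> is a mixture of the rows
  \<open>w (p, _)\<close>. Let \<open>z\<close> be the single row that dominates it: the contractivity hypothesis yields the
  two numerical inequalities for \<open>z\<close>, they carry over to the mixture, and there they give the
  bound for every amplified contraction.
\<close>

lemma amplification_bound_two_columns:
  fixes I :: "'i set" and K :: "'k set" and P :: "'p set" and Q :: "'q set"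
  assumes finI: "finite I" and finQ: "finite Q" and finP: "finite P"
    and H: "\<And>x1 x2 w. (\<And>v. (cmod (\<Sum>k\<in>K. v k * x1 k))\<^sup>2 + (cmod (\<Sum>k\<in>K. v k * x2 k))\<^sup>2 \<le> sqn K v) \<Longrightarrow>
        (cmod (\<Sum>k\<in>K. row_mult I w L1 k * x1 k))\<^sup>2 + (cmod (\<Sum>k\<in>K. row_mult I w L2 k * x2 k))\<^sup>2 \<le> sqn I w"
    and contr: "\<And>v. sqn Q (row_mult (P \<times> K) v X1) + sqn Q (row_mult (P \<times> K) v X2) \<le> sqn (P \<times> K) v"
  shows "sqn Q (row_mult (P \<times> K) (amplified_row I w L1) X1)
      + sqn Q (row_mult (P \<times> K) (amplified_row I w L2) X2) \<le> sqn (P \<times> I) w"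
proof -
  define \<psi> where "\<psi> = (\<lambda>p i. w (p, i))"
  define W where "W = sqn (P \<times> I) w"
  have W0: "0 \<le> W" by (simp add: W_def)
  define a1 a2 where "a1 = amplified_row I w L1" and "a2 = amplified_row I w L2"
  have amp: "amplified_row I w L (p, k) = row_mult I (\<psi> p) L k" for L :: "'i \<Rightarrow> 'k \<Rightarrow> complex" and p k
    by (simp add: amplified_row_def \<psi>_def)
  obtain z where z: "sqn I z = (\<Sum>p\<in>P. sqn I (\<psi> p))"
    "cip K (row_mult I z L1) (row_mult I z L2)
      = (\<Sum>p\<in>P. cip K (row_mult I (\<psi> p) L1) (row_mult I (\<psi> p) L2))"
    "(\<Sum>p\<in>P. sqn K (row_mult I (\<psi> p) L1) + sqn K (row_mult I (\<psi> p) L2))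
      \<le> sqn K (row_mult I z L1) + sqn K (row_mult I z L2)"
    using pure_state_dominates_mixture[OF finI finP] by blast
  have zW: "sqn I z = W" by (simp add: z W_def sqn_Times \<psi>_def)
  have zc: "cip K (row_mult I z L1) (row_mult I z L2) = cip (P \<times> K) a1 a2"
    unfolding z(2)
    by (simp add: a1_def a2_def cip_def sum.cartesian_product case_prod_unfold flip: amp)
  have zS: "sqn (P \<times> K) a1 + sqn (P \<times> K) a2 \<le> sqn K (row_mult I z L1) + sqn K (row_mult I z L2)"
    using z(3) by (simp add: sqn_Times a1_def a2_def amp sum.distrib)
  have *: "sqn K (row_mult I z L1) + sqn K (row_mult I z L2) \<le> 2 * W"
    "W * (sqn K (row_mult I z L1) + sqn K (row_mult I z L2))
      \<le> W\<^sup>2 + (cmod (cip K (row_mult I z L1) (row_mult I z L2)))\<^sup>2"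
    by (rule vector_state_bounds; use H[of _ _ z] in \<open>simp add: zW\<close>)+
  show ?thesis
    unfolding a1_def[symmetric] a2_def[symmetric] W_def[symmetric]
  proof (rule two_column_bound[OF finQ contr])
    show "sqn (P \<times> K) a1 + sqn (P \<times> K) a2 \<le> 2 * W" using zS *(1) by linarith
    have "W * (sqn (P \<times> K) a1 + sqn (P \<times> K) a2)
        \<le> W * (sqn K (row_mult I z L1) + sqn K (row_mult I z L2))"
      using zS W0 by (rule mult_left_mono)
    thus "W * (sqn (P \<times> K) a1 + sqn (P \<times> K) a2) \<le> W\<^sup>2 + (cmod (cip (P \<times> K) a1 a2))\<^sup>2"
      using *(2) by (simp add: zc)
  qed
qed

text \<open>
  Add the inequalities over all ordered pairs of distinct indices: each index occurs
  \<open>2 (card J - 1)\<close> times on the left, and there are \<open>card J (card J - 1)\<close> pairs.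
\<close>

lemma sum_le_half_if_pairs_le:
  fixes N :: "'j \<Rightarrow> real"
  assumes fin: "finite J" and card: "2 \<le> card J"
    and pairs: "\<And>i j. i \<in> J \<Longrightarrow> j \<in> J \<Longrightarrow> i \<noteq> j \<Longrightarrow> N i + N j \<le> W"
  shows "(\<Sum>j\<in>J. N j) \<le> real (card J) / 2 * W"
proof -
  define c where "c = real (card J)"
  \<comment> \<open>The diagonal pairs, which the hypothesis does not cover, are corrected explicitly.\<close>
  have "(\<Sum>i\<in>J. \<Sum>j\<in>J. N i + N j) \<le> (\<Sum>i\<in>J. \<Sum>j\<in>J. W + (if j = i then 2 * N i - W else 0))"
    by (intro sum_mono) (use pairs in auto)
  also have "\<dots> = c * c * W + (\<Sum>i\<in>J. 2 * N i - W)"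
    using fin by (simp add: sum.distrib c_def)
  also have "\<dots> = c * c * W + 2 * (\<Sum>i\<in>J. N i) - c * W"
    by (simp add: sum_subtractf sum_distrib_left c_def)
  also have "(\<Sum>i\<in>J. \<Sum>j\<in>J. N i + N j) = 2 * c * (\<Sum>i\<in>J. N i)"
    by (simp add: sum.distrib c_def sum_distrib_left mult.assoc)
  finally have "(c - 1) * (2 * (\<Sum>i\<in>J. N i)) \<le> (c - 1) * (c * W)"
    by (simp add: algebra_simps)
  hence "2 * (\<Sum>i\<in>J. N i) \<le> c * W"
    using card by (simp add: c_def)
  thus ?thesis by (simp add: c_def)
qed

text \<open>
  For the bound by \<open>card J / 2\<close>, restrict to two columns \<open>i\<close> and \<open>j\<close> by filling the other ones
  with zeros.
\<close>

lemma coefficient_bound: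
  assumes finI: "finite I" and finQ: "finite Q" and finP: "finite P"
    and finJ: "finite J" and J2: "2 \<le> card J"
    and H: "\<And>x w. contraction K J x \<Longrightarrow>
        sqn J (\<lambda>j. \<Sum>k\<in>K. row_mult I w (L j) k * x k j) \<le> sqn I w"
    and contr: "\<And>v. (\<Sum>j\<in>J. sqn Q (row_mult (P \<times> K) v (X j))) \<le> sqn (P \<times> K) v"
  shows "(\<Sum>j\<in>J. sqn Q (row_mult (P \<times> K) (amplified_row I w (L j)) (X j)))
      \<le> min (real (card I)) (real (card J) / 2) * sqn (P \<times> I) w"
proof -
  define N where "N = (\<lambda>j. sqn Q (row_mult (P \<times> K) (amplified_row I w (L j)) (X j)))"
  have "N i + N j \<le> sqn (P \<times> I) w" if ij: "i \<in> J" "j \<in> J" "i \<noteq> j" for i j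
    unfolding N_def
  proof (rule amplification_bound_two_columns[OF finI finQ finP])
    fix x1 x2 w
    assume c: "\<And>v. (cmod (\<Sum>k\<in>K. v k * x1 k))\<^sup>2 + (cmod (\<Sum>k\<in>K. v k * x2 k))\<^sup>2 \<le> sqn K v"
    define x where "x = (\<lambda>k l. if l = i then x1 k else if l = j then x2 k else 0)"
    have two: "sqn J (\<lambda>l. \<Sum>k\<in>K. a l k * x k l)
        = (cmod (\<Sum>k\<in>K. a i k * x1 k))\<^sup>2 + (cmod (\<Sum>k\<in>K. a j k * x2 k))\<^sup>2" for a
    proof -
      have "sqn J (\<lambda>l. \<Sum>k\<in>K. a l k * x k l) = sqn {i, j} (\<lambda>l. \<Sum>k\<in>K. a l k * x k l)"
        unfolding sqn_def using ij finJ by (intro sum.mono_neutral_right) (auto simp: x_def)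
      thus ?thesis using ij by (simp add: sqn_def x_def)
    qed
    have "contraction K J x"
      unfolding contraction_def row_mult_def two[of "\<lambda>_. v" for v] using c by blast
    from H[OF this, of w]
    show "(cmod (\<Sum>k\<in>K. row_mult I w (L i) k * x1 k))\<^sup>2
        + (cmod (\<Sum>k\<in>K. row_mult I w (L j) k * x2 k))\<^sup>2 \<le> sqn I w"
      unfolding two .
  next
    fix v
    have "(\<Sum>l\<in>{i, j}. sqn Q (row_mult (P \<times> K) v (X l))) \<le> (\<Sum>l\<in>J. sqn Q (row_mult (P \<times> K) v (X l)))"
      using ij finJ by (intro sum_mono2) auto
    also have "\<dots> \<le> sqn (P \<times> K) v" by (rule contr)
    finally show "sqn Q (row_mult (P \<times> K) v (X i)) + sqn Q (row_mult (P \<times> K) v (X j)) \<le> sqn (P \<times> K) v"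
      using ij by simp
  qed
  hence "(\<Sum>j\<in>J. N j) \<le> real (card J) / 2 * sqn (P \<times> I) w"
    by (rule sum_le_half_if_pairs_le[OF finJ J2])
  moreover have "(\<Sum>j\<in>J. N j) \<le> real (card I) * sqn (P \<times> I) w"
    unfolding N_def by (rule amplification_bound_card[OF finI finP H contr])
  ultimately show ?thesis by (simp add: N_def min_def)
qed

section \<open>Matrices\<close>

lemma l2_norm_nonneg: "0 \<le> l2_norm v"
  by (simp add: l2_norm_def)

lemma l2_norm_sq: "(l2_norm v)\<^sup>2 = sqn {..<dim_vec v} (\<lambda>i. v $ i)"
  by (simp add: l2_norm_def L2_set_def sqn_def sum_nonneg)

lemma sqn_mult_mat_vec:
  assumes "A \<in> carrier_mat r k"
  shows "sqn {..<r} (\<lambda>i. (A *\<^sub>v vec k v) $ i) = sqn {..<r} (\<lambda>i. \<Sum>j<k. A $$ (i, j) * v j)"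
  using assms by (simp add: sqn_def scalar_prod_def atLeast0LessThan)

text \<open>
  The bound is stated with a square root because the row estimates are for squared norms.
\<close>

lemma op_norm_le_iff:
  assumes A: "A \<in> carrier_mat r k" and C: "C \<ge> 0"
  shows "op_norm A \<le> ereal (sqrt C) \<longleftrightarrow>
    (\<forall>w. sqn {..<k} (row_mult {..<r} w (\<lambda>i j. A $$ (i, j))) \<le> C * sqn {..<r} w)"
    (is "?l \<longleftrightarrow> ?rows")
proof -
  have norm_Av: "(l2_norm (A *\<^sub>v vec k v))\<^sup>2 = sqn {..<r} (\<lambda>i. \<Sum>j<k. A $$ (i, j) * v j)" for v
    unfolding l2_norm_sq sqn_mult_mat_vec[OF A, symmetric] using A by simp
  have norm_v: "(l2_norm (vec k v))\<^sup>2 = sqn {..<k} v" for v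
    unfolding l2_norm_sq by (simp add: sqn_def)
  let ?cols = "\<forall>v. sqn {..<r} (\<lambda>i. \<Sum>j<k. A $$ (i, j) * v j) \<le> C * sqn {..<k} v"
  have "?l \<longleftrightarrow> (\<forall>v. l2_norm (vec k v) \<le> 1 \<longrightarrow> l2_norm (A *\<^sub>v vec k v) \<le> sqrt C)"
  proof -
    have "?l \<longleftrightarrow> (\<forall>v\<in>carrier_vec k. l2_norm v \<le> 1 \<longrightarrow> l2_norm (A *\<^sub>v v) \<le> sqrt C)"
      using A by (auto simp: op_norm_def SUP_le_iff)
    also have "carrier_vec k = range (vec k :: _ \<Rightarrow> complex vec)"
      by (auto simp: image_iff) (metis dim_vec eq_vecI index_vec carrier_vecD)
    finally show ?thesis by simp
  qed
  also have "\<dots> \<longleftrightarrow> (\<forall>v. sqn {..<k} v \<le> 1 \<longrightarrow> sqn {..<r} (\<lambda>i. \<Sum>j<k. A $$ (i, j) * v j) \<le> C)"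
  proof -
    have "l2_norm u \<le> 1 \<longleftrightarrow> (l2_norm u)\<^sup>2 \<le> 1" for u
      by (simp add: l2_norm_nonneg abs_square_le_1)
    moreover have "l2_norm u \<le> sqrt C \<longleftrightarrow> (l2_norm u)\<^sup>2 \<le> C" for u
      using C by (metis l2_norm_nonneg real_le_rsqrt real_sqrt_le_iff real_sqrt_unique)
    ultimately show ?thesis by (simp add: norm_Av norm_v)
  qed
  also have "\<dots> \<longleftrightarrow> ?cols"
  proof
    assume unit: "\<forall>v. sqn {..<k} v \<le> 1 \<longrightarrow> sqn {..<r} (\<lambda>i. \<Sum>j<k. A $$ (i, j) * v j) \<le> C"
    show ?cols
    proof
      fix v
      have scaled: "sqn {..<r} (\<lambda>i. \<Sum>j<k. A $$ (i, j) * (complex_of_real s * v j))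
          = s\<^sup>2 * sqn {..<r} (\<lambda>i. \<Sum>j<k. A $$ (i, j) * v j)" for s
      proof -
        have "(\<Sum>j<k. A $$ (i, j) * (complex_of_real s * v j))
            = complex_of_real s * (\<Sum>j<k. A $$ (i, j) * v j)" for i
          by (simp add: sum_distrib_left mult.left_commute)
        thus ?thesis by (simp add: sqn_scale)
      qed
      show "sqn {..<r} (\<lambda>i. \<Sum>j<k. A $$ (i, j) * v j) \<le> C * sqn {..<k} v"
      proof (cases "sqn {..<k} v = 0")
        case True
        hence "v j = 0" if "j < k" for j using sqn_eq_0D[of "{..<k}" v j] that by simp
        thus ?thesis by (simp add: sqn_def)
      next
        case False
        hence pos: "sqn {..<k} v > 0" using sqn_nonneg[of "{..<k}" v] by linarith
        define s where "s = 1 / sqrt (sqn {..<k} v)"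
        have s: "s\<^sup>2 = 1 / sqn {..<k} v" using pos by (simp add: s_def power_divide)
        have "sqn {..<k} (\<lambda>j. complex_of_real s * v j) \<le> 1"
          using pos by (simp add: sqn_scale s)
        hence "s\<^sup>2 * sqn {..<r} (\<lambda>i. \<Sum>j<k. A $$ (i, j) * v j) \<le> C"
          using unit[THEN spec, of "\<lambda>j. complex_of_real s * v j"] unfolding scaled by simp
        thus ?thesis using pos by (simp add: s field_simps)
      qed
    qed
  next
    assume cols: ?cols
    show "\<forall>v. sqn {..<k} v \<le> 1 \<longrightarrow> sqn {..<r} (\<lambda>i. \<Sum>j<k. A $$ (i, j) * v j) \<le> C"
    proof (intro allI impI)
      fix v assume "sqn {..<k} v \<le> 1"
      hence "C * sqn {..<k} v \<le> C" using C by (simp add: mult_left_le)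
      thus "sqn {..<r} (\<lambda>i. \<Sum>j<k. A $$ (i, j) * v j) \<le> C" using cols order_trans by blast
    qed
  qed
  also have "\<dots> \<longleftrightarrow> ?rows"
  proof
    assume ?cols
    thus ?rows unfolding row_mult_def
      by (intro allI contraction_transpose C) blast
  next
    assume rows: ?rows
    show ?cols
    proof
      fix v
      have rows': "sqn {..<k} (\<lambda>j. \<Sum>i<r. A $$ (i, j) * w i) \<le> C * sqn {..<r} w" for w
        using rows[THEN spec, of w] by (simp add: row_mult_def[abs_def] mult.commute)
      have "sqn {..<r} (\<lambda>i. \<Sum>j<k. v j * A $$ (i, j)) \<le> C * sqn {..<k} v"
        by (rule contraction_transpose[where K = "\<lambda>j i. A $$ (i, j)", OF rows' C])
      thus "sqn {..<r} (\<lambda>i. \<Sum>j<k. A $$ (i, j) * v j) \<le> C * sqn {..<k} v"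
        by (simp add: mult.commute)
    qed
  qed
  finally show ?thesis .
qed

definition matrix_unit :: "nat \<Rightarrow> nat \<Rightarrow> nat \<Rightarrow> nat \<Rightarrow> complex mat" where
  "matrix_unit m n k j = mat m n (\<lambda>(a, b). if a = k \<and> b = j then 1 else 0)"

definition column_coeff ::
  "nat \<Rightarrow> nat \<Rightarrow> (complex mat \<Rightarrow> complex mat) \<Rightarrow> nat \<Rightarrow> nat \<Rightarrow> nat \<Rightarrow> complex" where
  "column_coeff m n T j i k = T (matrix_unit m n k j) $$ (i, j)"

text \<open>
  Multiplying from the right with the diagonal matrix unit at \<open>j\<close> isolates the \<open>j\<close>-th column, so
  the \<open>j\<close>-th column of \<open>T x\<close> depends linearly on the \<open>j\<close>-th column of \<open>x\<close> alone. The isolated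
  column is built up entry by entry, which makes the proof an induction over the rows.
\<close>

lemma right_diag_module_map_columnwise:
  assumes T: "right_diag_module_map m n T" and x: "x \<in> carrier_mat m n" and i: "i < m" and j: "j < n"
  shows "T x $$ (i, j) = (\<Sum>k<m. column_coeff m n T j i k * x $$ (k, j))"
proof -
  note T' = T[unfolded right_diag_module_map_def linear_on_mat_def]
  have Tc: "T y \<in> carrier_mat m n" if "y \<in> carrier_mat m n" for y using T' that by blast
  define part where "part = (\<lambda>r. mat m n (\<lambda>(a, b). if b = j \<and> a < r then x $$ (a, b) else 0))"
  have pc: "part r \<in> carrier_mat m n" for r by (simp add: part_def)
  have uc: "matrix_unit m n k j \<in> carrier_mat m n" for k by (simp add: matrix_unit_def)
  have part: "T (part r) $$ (i, j) = (\<Sum>k<r. column_coeff m n T j i k * x $$ (k, j))" if "r \<le> m" for r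
    using that
  proof (induction r)
    case 0
    have "part 0 = 0 \<cdot>\<^sub>m part 0" by (rule eq_matI) (auto simp: part_def)
    hence "T (part 0) = 0 \<cdot>\<^sub>m T (part 0)" using T' pc by metis
    hence "T (part 0) $$ (i, j) = (0 \<cdot>\<^sub>m T (part 0)) $$ (i, j)" by simp
    also have "\<dots> = 0" using Tc[OF pc[of 0]] i j by simp
    finally show ?case by simp
  next
    case (Suc r)
    have "part (Suc r) = part r + x $$ (r, j) \<cdot>\<^sub>m matrix_unit m n r j"
      by (rule eq_matI) (use Suc.prems in \<open>auto simp: part_def matrix_unit_def less_Suc_eq\<close>)
    hence "T (part (Suc r)) = T (part r) + x $$ (r, j) \<cdot>\<^sub>m T (matrix_unit m n r j)"
      using T' pc uc by (metis smult_carrier_mat)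
    thus ?case
      using Suc i j Tc[OF pc[of r]] Tc[OF uc[of r]] by (simp add: column_coeff_def)
  qed
  define d where "d = mat n n (\<lambda>(a, b). if a = j \<and> b = j then 1 else 0 :: complex)"
  have d: "d \<in> diagonal_algebra n"
    by (auto simp: d_def diagonal_algebra_def diagonal_mat_def)
  have yd: "(y * d) $$ (a, b) = (if b = j then y $$ (a, b) else 0)"
    if "y \<in> carrier_mat m n" "a < m" "b < n" for y a b
  proof -
    have "(y * d) $$ (a, b) = (\<Sum>l<n. y $$ (a, l) * (if l = j \<and> b = j then 1 else 0))"
      using that by (simp add: d_def scalar_prod_def atLeast0LessThan)
    also have "\<dots> = (\<Sum>l<n. if l = j then (if b = j then y $$ (a, b) else 0) else 0)"
      by (intro sum.cong) auto
    finally show ?thesis using j by simp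
  qed
  have "x * d = part m"
    by (rule eq_matI) (use x yd[OF x] in \<open>auto simp: part_def d_def\<close>)
  hence "T x * d = T (part m)" using T' x d by metis
  hence "T x $$ (i, j) = T (part m) $$ (i, j)"
    using yd[OF Tc[OF x] i j] by simp
  thus ?thesis using part[of m] by simp
qed

lemma bij_betw_block_index:
  "bij_betw (\<lambda>(p, k). p * m + k) ({..<s} \<times> {..<m}) {..<s * (m::nat)}"
proof (rule bij_betw_byWitness[where f' = "\<lambda>i. (i div m, i mod m)"])
  show "(\<lambda>(p, k). p * m + k) ` ({..<s} \<times> {..<m}) \<subseteq> {..<s * m}"
  proof clarsimp
    fix p k assume "p < s" "k < m"
    hence "p * m + k < Suc p * m" "Suc p * m \<le> s * m" by (simp_all only: mult_le_mono1 Suc_leI) simp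
    thus "p * m + k < s * m" by linarith
  qed
  show "(\<lambda>i. (i div m, i mod m)) ` {..<s * m} \<subseteq> {..<s} \<times> {..<m}"
    by (auto simp: less_mult_imp_div_less) (metis mod_less_divisor mult_0_right not_gr_zero not_less0)
qed auto

lemma sum_blocks: "(\<Sum>i<s * m. f i) = (\<Sum>p<s. \<Sum>k<m. f (p * m + k))" for m :: nat
proof -
  have "(\<Sum>i<s * m. f i) = (\<Sum>x\<in>{..<s} \<times> {..<m}. f ((\<lambda>(p, k). p * m + k) x))"
    by (rule sum.reindex_bij_betw[OF bij_betw_block_index, symmetric])
  also have "\<dots> = (\<Sum>p<s. \<Sum>k<m. f (p * m + k))"
    by (simp add: sum.cartesian_product case_prod_unfold)
  finally show ?thesis .
qed

lemma sqn_blocks: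
  "sqn {..<s * m} v = sqn ({..<s} \<times> {..<m}) (\<lambda>(p, k). v (p * m + k))" for m :: nat
  by (simp add: sqn_def sum_blocks sum.cartesian_product')

lemma row_mult_blocks:
  "row_mult {..<s * m} v A
   = row_mult ({..<s} \<times> {..<m}) (\<lambda>(p, k). v (p * m + k)) (\<lambda>(p, k). A (p * m + k))" for m :: nat
  unfolding row_mult_def by (simp add: sum_blocks sum.cartesian_product')

lemma sqn_row_mult_blocks:
  "sqn {..<t * n} (row_mult {..<s * m} v A)
   = (\<Sum>j<n. sqn {..<t} (row_mult ({..<s} \<times> {..<m}) (\<lambda>(p, k). v (p * m + k))
       (\<lambda>(p, k) q. A (p * m + k) (q * n + j))))" for m n :: nat
  by (simp add: sqn_blocks sqn_Times' row_mult_blocks)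
    (simp add: row_mult_def[abs_def] case_prod_unfold)

lemma coefficients_of_contractive_map:
  assumes T: "right_diag_module_map m n T" and norm: "map_norm m n T \<le> 1"
    and x: "contraction {..<m} {..<n} x"
  shows "sqn {..<n} (\<lambda>j. \<Sum>k<m. row_mult {..<m} w (column_coeff m n T j) k * x k j) \<le> sqn {..<m} w"
proof -
  define y where "y = mat m n (\<lambda>(k, j). x k j)"
  have y: "y \<in> carrier_mat m n" by (simp add: y_def)
  have yx: "y $$ (k, j) = x k j" if "k < m" "j < n" for k j using that by (simp add: y_def)
  have Ty: "T y \<in> carrier_mat m n"
    using T y by (simp add: right_diag_module_map_def linear_on_mat_def)
  have "sqn {..<n} (row_mult {..<m} v (\<lambda>i j. y $$ (i, j))) = sqn {..<n} (row_mult {..<m} v x)" for v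
    by (simp add: sqn_def row_mult_def yx)
  hence "op_norm y \<le> 1"
    using op_norm_le_iff[OF y, of 1] x by (simp add: contraction_def one_ereal_def)
  hence "op_norm (T y) \<le> 1"
    using norm y unfolding map_norm_def SUP_le_iff by blast
  hence "sqn {..<n} (row_mult {..<m} w (\<lambda>i j. T y $$ (i, j))) \<le> sqn {..<m} w"
    using op_norm_le_iff[OF Ty, of 1] by (simp add: one_ereal_def)
  moreover have "row_mult {..<m} w (\<lambda>i j. T y $$ (i, j)) j
      = (\<Sum>k<m. row_mult {..<m} w (column_coeff m n T j) k * x k j)" if "j < n" for j
  proof -
    have "row_mult {..<m} w (\<lambda>i j. T y $$ (i, j)) j
        = (\<Sum>i<m. \<Sum>k<m. w i * column_coeff m n T j i k * x k j)"
      unfolding row_mult_def using that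
      by (intro sum.cong refl)
        (simp add: right_diag_module_map_columnwise[OF T y] yx sum_distrib_left mult.assoc)
    also have "\<dots> = (\<Sum>k<m. \<Sum>i<m. w i * column_coeff m n T j i k * x k j)"
      by (rule sum.swap)
    finally show ?thesis by (simp add: row_mult_def sum_distrib_right)
  qed
  ultimately show ?thesis by (simp add: sqn_def)
qed

lemma op_norm_amplification_le:
  assumes n: "2 \<le> n" and T: "right_diag_module_map m n T" and norm: "map_norm m n T \<le> 1"
    and X: "X \<in> carrier_mat (s * m) (t * n)" and X1: "op_norm X \<le> 1"
  shows "op_norm (amplification m n s t T X) \<le> ereal (sqrt (min (real m) (real n / 2)))"
proof -
  define Y where "Y = amplification m n s t T X"
  have Y: "Y \<in> carrier_mat (s * m) (t * n)" by (simp add: Y_def amplification_def)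
  define P K :: "nat set" where "P = {..<s}" and "K = {..<m}"
  define X' where "X' = (\<lambda>j (p, k) q. X $$ (p * m + k, q * n + j))"
  have contr: "(\<Sum>j<n. sqn {..<t} (row_mult (P \<times> K) v (X' j))) \<le> sqn (P \<times> K) v" for v
  proof -
    define u where "u = (\<lambda>i. v (i div m, i mod m))"
    have u: "u (p * m + k) = v (p, k)" if "k < m" for p k
      using that by (simp add: u_def)
    have "sqn {..<t * n} (row_mult {..<s * m} u (\<lambda>i j. X $$ (i, j))) \<le> sqn {..<s * m} u"
      using op_norm_le_iff[OF X, of 1] X1 by (simp add: one_ereal_def)
    moreover have "sqn {..<s * m} u = sqn (P \<times> K) v"
      by (simp add: sqn_def sum_blocks sum.cartesian_product' u P_def K_def)
    moreover have "row_mult (P \<times> K) (\<lambda>(p, k). u (p * m + k)) Z = row_mult (P \<times> K) v Z"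
      for Z :: "nat \<times> nat \<Rightarrow> nat \<Rightarrow> complex"
      by (simp add: row_mult_def sum.cartesian_product' u K_def fun_eq_iff)
    ultimately show ?thesis
      unfolding sqn_row_mult_blocks by (simp add: X'_def flip: P_def K_def)
  qed
  have "sqn {..<t * n} (row_mult {..<s * m} w (\<lambda>i j. Y $$ (i, j)))
      \<le> min (real m) (real n / 2) * sqn {..<s * m} w" for w
  proof -
    define w' where "w' = (\<lambda>(p, k). w (p * m + k))"
    have entry: "Y $$ (p * m + i, q * n + j)
        = (\<Sum>k<m. column_coeff m n T j i k * X' j (p, k) q)"
      if "p < s" "i < m" "q < t" "j < n" for p i q j
    proof -
      have "p * m + i < s * m" "q * n + j < t * n"
        using bij_betw_block_index[of m s] bij_betw_block_index[of n t] that
        by (auto simp: bij_betw_def)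
      moreover have "mat_block m n X p q \<in> carrier_mat m n" by (simp add: mat_block_def)
      ultimately show ?thesis
        using that by (simp add: Y_def amplification_def right_diag_module_map_columnwise[OF T])
          (simp add: mat_block_def X'_def)
    qed
    have row: "row_mult (P \<times> K) w' (\<lambda>(p, i) q. Y $$ (p * m + i, q * n + j)) q
        = row_mult (P \<times> K) (amplified_row K w' (column_coeff m n T j)) (X' j) q"
      if "q < t" "j < n" for q j
    proof -
      have "row_mult (P \<times> K) w' (\<lambda>(p, i) q. Y $$ (p * m + i, q * n + j)) q
          = (\<Sum>p<s. \<Sum>i<m. \<Sum>k<m. w' (p, i) * column_coeff m n T j i k * X' j (p, k) q)"
        unfolding row_mult_def sum.cartesian_product' P_def K_def
        by (intro sum.cong refl) (simp add: entry that sum_distrib_left mult.assoc)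
      also have "\<dots> = (\<Sum>p<s. \<Sum>k<m. \<Sum>i<m. w' (p, i) * column_coeff m n T j i k * X' j (p, k) q)"
        by (intro sum.cong refl sum.swap)
      finally show ?thesis
        by (simp add: row_mult_def sum.cartesian_product' amplified_row_def P_def K_def sum_distrib_right)
    qed
    have "sqn {..<t * n} (row_mult {..<s * m} w (\<lambda>i j. Y $$ (i, j)))
        = (\<Sum>j<n. sqn {..<t} (row_mult (P \<times> K) w' (\<lambda>(p, i) q. Y $$ (p * m + i, q * n + j))))"
      unfolding sqn_row_mult_blocks w'_def P_def K_def ..
    also have "\<dots> = (\<Sum>j<n. sqn {..<t} (row_mult (P \<times> K)
        (amplified_row K w' (column_coeff m n T j)) (X' j)))"
      by (simp add: sqn_def row)
    also have "\<dots> \<le> min (real (card K)) (real (card {..<n}) / 2) * sqn (P \<times> K) w'"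
    proof (rule coefficient_bound)
      show "sqn {..<n} (\<lambda>j. \<Sum>k\<in>K. row_mult K u (column_coeff m n T j) k * x k j) \<le> sqn K u"
        if "contraction K {..<n} x" for x u
        using coefficients_of_contractive_map[OF T norm] that unfolding K_def .
    qed (use n contr in \<open>simp_all add: P_def K_def\<close>)
    finally show ?thesis by (simp add: K_def P_def w'_def sqn_blocks)
  qed
  thus ?thesis
    using op_norm_le_iff[OF Y, of "min (real m) (real n / 2)"] by (simp add: Y_def)
qed

section \<open>The bound on the constant\<close>

theorem theorem5p5:
  fixes m n :: nat
  assumes "n \<ge> 2"
  shows "C_const m n \<le> ereal (sqrt (min (real m) (real n / 2)))"
  unfolding C_const_def cb_norm_def map_norm_def[of "_ * m"]
  using op_norm_amplification_le[OF assms] by (auto intro!: SUP_least)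

end
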